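(* Let $H$ be a real Hilbert space, $T:H\to 2^H$ a maximal monotone operator with $S:=T^{-1}(0)\neq\emptyset$, and for $\rho>0$ let $\mathsf{J}_\rho=(I+\rho T)^{-1}$ be the resolvent of $T$. Let $u,z_0\in H$, let $(c_n)$ be positive reals, $(\lambda_n),(\gamma_n),(\delta_n)\subset(0,1)$ with $\lambda_n+\gamma_n+\delta_n=1$ for all $n$, let $(e_n)\subset H$, and let $$z_{n+1}=\lambda_n u+\gamma_n z_n+\delta_n\mathsf{J}_{c_n}(z_n)+e_n\quad(n\in\mathbb{N}).$$ Assume that there exist $a,c\in\mathbb{N}\setminus\{0\}$ and monotone (nondecreasing) functions $\ell,L,\Gamma,E:\mathbb{N}\to\mathbb{N}$ such that: (Q1) $\forall k\,\forall n\ge \ell(k)\ (\lambda_n\le \frac{1}{k+1})$; (Q2) $\forall k\ (\sum_{i=1}^{L(k)}\lambda_i\ge k)$; (Q3) $\forall m\ (\frac1a\le\gamma_m\le 1-\frac1a)$; (Q4) $\forall n\ (c_n\ge \frac1c)$; (Q5) $\forall k\,\forall n\ge\Gamma(k)\ (|c_{n+1}-c_n|\le\frac{1}{k+1})$; (Q6) $\forall k,n\ (\sum_{i=E(k)+1}^{E(k)+n}\|e_i\|\le\frac{1}{k+1})$. Let $\mathcal{C}:\mathbb{N}\to\mathbb{N}$ be monotone with $c_n\le\mathcal{C}(n)$ for all $n$. Let $N_1,N_2,N_3\in\mathbb{N}$ with $N_1\ge\|u\|$, $N_2\ge\sum_{i=0}^{E(0)}\|e_i\|+1$, and, for some $s\in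 S$, $N_3\ge\max\{\|u-s\|,\|z_0-s\|\}$. Let $\phi$ be the functional defined in the context below (built from these data). Then $$\forall k\in\mathbb{N}\ \forall f:\mathbb{N}\to\mathbb{N}\ \exists n\le\phi(k,f)\ \forall i,j\in[n,n+f(n)]\ \Big(\|z_i-z_j\|\le\frac{1}{k+1}\Big).$$
   Context: $[x,y]$ denotes the set of natural numbers between $x$ and $y$. For $f:\mathbb{N}\to\mathbb{N}$, $f^{\mathrm{maj}}(n):=\max_{i\le n}f(i)$, $f+1$ denotes $m\mapsto f(m)+1$, and $f^{(r)}$ is the $r$-fold iterate of $f$ ($f^{(0)}=\mathrm{Id}$). $\ln$ is the natural logarithm. Define: $N_0:=N_2+N_3$, $N:=\max\{2N_3,N_2+N_3\}$, $N':=2aN_0+N_1+N_3$. $\nu(k):=\max\{\Gamma(10acN_0(k+1)),\ \ell(10a(N_0+N_1+N_3)(k+1)),\ E(5a(k+1))+1\}$. For $K,M,t,B\in\mathbb{N}$ and monotone $g$: with $P:=B(K+1)$, $n_i:=M+it$ ($0\le i\le P$), $r_P:=0$, $r_i:=t+r_{i+1}+g(n_{i+1}+r_{i+1})$ for $i<P$, put $\theta(K,M,t,B,g):=M+(P-1)t+r_0$. For $k\in\mathbb{N}$: $t_k:=\max\{2N'a(k+1),1\}$, $R_k:=t_k(2t_k+1)a^{t_k}(k+1)$, and $\chi_0(k,f):=\theta\big(R_k-1,\ \max\{a,\nu(R_k-1)\},\ t_k,\ 2N',\ m\mapsto t_k+f(m)\big)$. $\mu(k):=\max\{\ell(4a(k+1)(N_0+N_3)),\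 E(4a(k+1))+1\}$; $\tilde f_k(m):=\mu(k)+f(\max\{\mu(k),m\})$; $\xi(k,f):=\max\{\mu(2k+1),\ \chi_0(4a(k+1),\tilde f_{2k+1})\}$. For $k$ and $f$: $R:=4N^4(k+1)^2$, $g_f(m):=f(\xi(m,f+1))$, $\check g_f(m):=\max\{g_f(24N(m+1)^2),\,24N(m+1)^2\}$, and $\psi(k,f):=\xi\big(24N(\check g_f^{(R)}(0)+1)^2,\ f+1\big)$. $\zeta(k,n):=\mathcal{C}(n)c(k+1)-1$; $h_f(m):=\zeta((1+4N)(f(m)+1)-1,\ f(m))$; $\Psi(k,f):=\psi(2k+1,h_f)$. $M_1:=3N_2+4N$, $M_2:=M_1+2(N_3+N)$, $G(k):=E(M_2(k+1))$, $D:=4N^2$. For $k$ and monotone $f$: $h'(m):=\max\{m,G(4k+3)+1\}+\lceil\ln(4D(k+1))\rceil$, $g'(m):=4(k+1)(f(L(h'(m))+1)+1)$, $\Theta(k,f):=L(h'(\Psi(4k+3,g')))+1$. Finally $\phi(k,f):=\Theta\big(4(k+1)^2-1,\ m\mapsto m+f^{\mathrm{maj}}(m)\big)$. *)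

theory Defs
  imports "HOL-Analysis.Analysis"
begin

(* Set-valued operators T : H -> 2^H are functions into sets; a real Hilbert space is a type
   of sort {real_inner, complete_space}. *)

definition monotone_operator :: "('a::real_inner \<Rightarrow> 'a set) \<Rightarrow> bool" where
  "monotone_operator T \<longleftrightarrow>
     (\<forall>x y. \<forall>v\<in>T x. \<forall>w\<in>T y. 0 \<le> (x - y) \<bullet> (v - w))"

definition maximal_monotone_operator :: "('a::real_inner \<Rightarrow> 'a set) \<Rightarrow> bool" where
  "maximal_monotone_operator T \<longleftrightarrow>
     monotone_operator T \<and>
     (\<forall>T'. monotone_operator T' \<and> (\<forall>x. T x \<subseteq> T' x) \<longrightarrow> T' = T)"

definition zeros :: "('a::real_vector \<Rightarrow> 'a set) \<Rightarrow> 'a set" where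
  "zeros T = {x. 0 \<in> T x}"

(* J_rho = (I + rho T)^{-1} as a function: J_rho x is the unique w with x in w + rho T(w).
   For maximal monotone T and rho > 0 it is total and single-valued (Minty). *)
definition resolvent :: "('a::real_vector \<Rightarrow> 'a set) \<Rightarrow> real \<Rightarrow> 'a \<Rightarrow> 'a" where
  "resolvent T \<rho> x = (THE w. x \<in> (\<lambda>v. w + \<rho> *\<^sub>R v) ` T w)"

definition maj :: "(nat \<Rightarrow> nat) \<Rightarrow> nat \<Rightarrow> nat" where
  "maj f n = Max (f ` {..n})"

(* r_i := t + r_{i+1} + g (n_{i+1} + r_{i+1}), r_P := 0, n_i := M + i t.  The recursion runs
   downwards from P, so it is indexed by the distance j to P:  theta_r M t P g j = r_{P-j}. *)
primrec theta_r :: "nat \<Rightarrow> nat \<Rightarrow> nat \<Rightarrow> (nat \<Rightarrow> nat) \<Rightarrow> nat \<Rightarrow> nat" where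
  "theta_r M t P g 0 = 0"
| "theta_r M t P g (Suc j) =
     t + theta_r M t P g j + g ((M + (P - j) * t) + theta_r M t P g j)"

definition theta :: "nat \<Rightarrow> nat \<Rightarrow> nat \<Rightarrow> nat \<Rightarrow> (nat \<Rightarrow> nat) \<Rightarrow> nat" where
  "theta K M t B g = (let P = B * (K + 1) in M + (P - 1) * t + theta_r M t P g P)"

(* The locale carries no assumptions; it only fixes the data from which the functionals are
   built.  The subtractions below are on nat; they do not truncate under the hypotheses
   a, c, N2 >= 1 and C(n) >= 1 that hold wherever phi is used. *)
locale rate_data =
  fixes a c :: nat
    and \<l> L \<Gamma> E \<C> :: "nat \<Rightarrow> nat"
    and N1 N2 N3 :: nat
begin

definition N0 :: nat where "N0 = N2 + N3"
definition N :: nat where "N = max (2 * N3) (N2 + N3)"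
definition N' :: nat where "N' = 2 * a * N0 + N1 + N3"

definition \<nu> :: "nat \<Rightarrow> nat" where
  "\<nu> k = Max {\<Gamma> (10 * a * c * N0 * (k + 1)),
             \<l> (10 * a * (N0 + N1 + N3) * (k + 1)),
             E (5 * a * (k + 1)) + 1}"

definition tt :: "nat \<Rightarrow> nat" where
  "tt k = max (2 * N' * a * (k + 1)) 1"

definition RR :: "nat \<Rightarrow> nat" where
  "RR k = tt k * (2 * tt k + 1) * a ^ tt k * (k + 1)"

definition \<chi>0 :: "nat \<Rightarrow> (nat \<Rightarrow> nat) \<Rightarrow> nat" where
  "\<chi>0 k f = theta (RR k - 1) (max a (\<nu> (RR k - 1))) (tt k) (2 * N') (\<lambda>m. tt k + f m)"

definition \<mu> :: "nat \<Rightarrow> nat" where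
  "\<mu> k = max (\<l> (4 * a * (k + 1) * (N0 + N3))) (E (4 * a * (k + 1)) + 1)"

definition f_tilde :: "nat \<Rightarrow> (nat \<Rightarrow> nat) \<Rightarrow> nat \<Rightarrow> nat" where
  "f_tilde k f m = \<mu> k + f (max (\<mu> k) m)"

definition \<xi> :: "nat \<Rightarrow> (nat \<Rightarrow> nat) \<Rightarrow> nat" where
  "\<xi> k f = max (\<mu> (2 * k + 1)) (\<chi>0 (4 * a * (k + 1)) (f_tilde (2 * k + 1) f))"

definition g_of :: "(nat \<Rightarrow> nat) \<Rightarrow> nat \<Rightarrow> nat" where
  "g_of f m = f (\<xi> m (\<lambda>i. f i + 1))"

definition g_check :: "(nat \<Rightarrow> nat) \<Rightarrow> nat \<Rightarrow> nat" where
  "g_check f m = max (g_of f (24 * N * (m + 1)\<^sup>2)) (24 * N * (m + 1)\<^sup>2)"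

definition \<psi> :: "nat \<Rightarrow> (nat \<Rightarrow> nat) \<Rightarrow> nat" where
  "\<psi> k f = (let R = 4 * N ^ 4 * (k + 1)\<^sup>2
           in \<xi> (24 * N * ((g_check f ^^ R) 0 + 1)\<^sup>2) (\<lambda>m. f m + 1))"

definition \<zeta> :: "nat \<Rightarrow> nat \<Rightarrow> nat" where
  "\<zeta> k n = \<C> n * c * (k + 1) - 1"

definition h_of :: "(nat \<Rightarrow> nat) \<Rightarrow> nat \<Rightarrow> nat" where
  "h_of f m = \<zeta> ((1 + 4 * N) * (f m + 1) - 1) (f m)"

definition \<Psi> :: "nat \<Rightarrow> (nat \<Rightarrow> nat) \<Rightarrow> nat" where
  "\<Psi> k f = \<psi> (2 * k + 1) (h_of f)"

definition M1 :: nat where "M1 = 3 * N2 + 4 * N"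
definition M2 :: nat where "M2 = M1 + 2 * (N3 + N)"
definition G :: "nat \<Rightarrow> nat" where "G k = E (M2 * (k + 1))"
definition D :: nat where "D = 4 * N\<^sup>2"

definition h' :: "nat \<Rightarrow> nat \<Rightarrow> nat" where
  "h' k m = max m (G (4 * k + 3) + 1) + nat \<lceil>ln (real (4 * D * (k + 1)))\<rceil>"

definition g' :: "nat \<Rightarrow> (nat \<Rightarrow> nat) \<Rightarrow> nat \<Rightarrow> nat" where
  "g' k f m = 4 * (k + 1) * (f (L (h' k m) + 1) + 1)"

definition \<Theta> :: "nat \<Rightarrow> (nat \<Rightarrow> nat) \<Rightarrow> nat" where
  "\<Theta> k f = L (h' k (\<Psi> (4 * k + 3) (g' k f))) + 1"

definition \<phi> :: "nat \<Rightarrow> (nat \<Rightarrow> nat) \<Rightarrow> nat" where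
  "\<phi> k f = \<Theta> (4 * (k + 1)\<^sup>2 - 1) (\<lambda>m. m + maj f m)"

end

end

(* The errors are summable, so the orbit stays within N0 of a zero s.  A quantitative version of
   Suzuki's lemma makes z_{n+1} - z_n metastable, hence also z_n - J z_n for J the resolvent with
   parameter 1/c, the smallest step size allowed.  The metric projection of u onto the zero set is
   replaced by an approximate fixed point x of J that is almost optimal among the approximate fixed
   points of a coarser level: finitely many improvements of |u - x|^2 suffice, and comparing x with
   points on the segment from x to z_i bounds <u - x, z_i - x>.  A quantitative Xu recursion for
   |z_n - x|^2 then finishes.  No weak compactness is used, not even for Minty's theorem. *)

theory Submission
  imports Defs
begin

text \<open>The obstacle is the order of the choices. The accuracy demanded of x as a fixed point
  grows with \<open>f n\<close>, while n depends on the level at which x is almost optimal. So each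
  stage takes a counterfunction and bounds n in advance, and monotonicity of the data lets a bound
  stand for the unknown value. The step sizes cause an asymmetry: they are at least 1/c, but bounded
  above only by \<open>\<C> n\<close>. For the orbit, the passage from the moving resolvents to the
  fixed J costs a factor 2. For x, the way back costs up to c times \<open>\<C>\<close>, so it is
  made on a finite stretch only, and \<open>h_of\<close> pays for it. Levels are squared in
  \<open>\<psi>\<close> because a convex combination of \<delta>-approximate fixed points of J is
  one only up to the order of the square root of \<delta>. Minty's theorem comes in because
  \<open>resolvent\<close> is a definite description: every estimate on it rests on existence and
  uniqueness of the described point.\<close>

section \<open>Minty's theorem and resolvents\<close>

text \<open>The minimiser of F over the convex hull K of the points (x, v, <x, v>) need not exist, but F is
  uniformly convex in q = x - v, so q converges along any minimising sequence; half of its limit is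
  the required point, by the first-order optimality condition.\<close>

lemma monotone_graph_common_point:
  fixes A :: "('a::{real_inner, complete_space} \<times> 'a) set"
  assumes ne: "A \<noteq> {}"
    and mono: "\<And>x v y w. (x, v) \<in> A \<Longrightarrow> (y, w) \<in> A \<Longrightarrow> 0 \<le> (x - y) \<bullet> (v - w)"
  obtains w where "\<And>x v. (x, v) \<in> A \<Longrightarrow> 0 \<le> (x - w) \<bullet> (v + w)"
proof -
  define B where "B = (\<lambda>(x, v). (x, v, x \<bullet> v)) ` A"
  define K where "K = convex hull B"
  have BK: "B \<subseteq> K" unfolding K_def by (rule hull_subset)
  have Kconv: "convex K" unfolding K_def by (rule convex_convex_hull)
  define q where "q = (\<lambda>p::'a \<times> 'a \<times> real. fst p - fst (snd p))"
  define F where "F = (\<lambda>p::'a \<times> 'a \<times> real. (q p \<bullet> q p) / 4 + snd (snd p))"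
  \<comment> \<open>For points of \<open>B\<close> this is the monotonicity inequality multiplied
    out, with <x, v> replaced by the third coordinate. It is thus affine in each argument and passes
    from \<open>B\<close> to \<open>K\<close> one argument at a time; on the diagonal it says <x, v>
    \<le> r.\<close>
  define pos where "pos = (\<lambda>(p::'a \<times> 'a \<times> real) (p'::'a \<times> 'a \<times> real).
      0 \<le> snd (snd p) + snd (snd p') - fst p \<bullet> fst (snd p') - fst p' \<bullet> fst (snd p))"
  have pos_sym: "pos p p' \<Longrightarrow> pos p' p" for p p'
    by (simp add: pos_def algebra_simps)
  have pos_convex: "convex {p'. pos p p'}" for p
  proof (rule convexI)
    fix x y and s t :: real
    assume xy: "x \<in> {p'. pos p p'}" "y \<in> {p'. pos p p'}" and st: "0 \<le> s" "0 \<le> t" "s + t = 1"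
    define l where "l = (\<lambda>p'. snd (snd p) + snd (snd p') - fst p \<bullet> fst (snd p') - fst p' \<bullet> fst (snd p))"
    have "l (s *\<^sub>R x + t *\<^sub>R y) = s * l x + t * l y + (1 - (s + t)) * snd (snd p)"
      by (simp add: l_def algebra_simps inner_add_left inner_add_right)
    moreover have "0 \<le> l x" "0 \<le> l y"
      using xy by (auto simp: pos_def l_def)
    ultimately have "0 \<le> l (s *\<^sub>R x + t *\<^sub>R y)" using st by simp
    thus "s *\<^sub>R x + t *\<^sub>R y \<in> {p'. pos p p'}" by (simp add: pos_def l_def)
  qed
  have pos_B: "pos p p'" if "p \<in> B" "p' \<in> B" for p p'
    using that mono by (fastforce simp: B_def pos_def inner_diff_left inner_diff_right inner_commute)
  have pos_BK: "pos p p'" if "p \<in> B" "p' \<in> K" for p p'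
  proof -
    have "K \<subseteq> {p'. pos p p'}" unfolding K_def
      using pos_B[OF that(1)] pos_convex by (intro hull_minimal) blast+
    thus ?thesis using that by auto
  qed
  have pos_K: "pos p p'" if "p \<in> K" "p' \<in> K" for p p'
  proof -
    have "K \<subseteq> {p'. pos p p'}" unfolding K_def
      using pos_BK[OF _ that(1)] pos_sym pos_convex by (intro hull_minimal) blast+
    thus ?thesis using that by auto
  qed
  have F_nonneg: "0 \<le> F p" if "p \<in> K" for p
  proof -
    obtain x v r where p: "p = (x, v, r)" by (cases p) auto
    have "x \<bullet> v \<le> r" using pos_K[OF that that] by (simp add: pos_def p)
    moreover have "F p = ((x + v) \<bullet> (x + v)) / 4 + (r - x \<bullet> v)"
      by (simp add: F_def q_def p inner_add_left inner_add_right inner_diff_left inner_diff_right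
          inner_commute field_simps)
    ultimately show ?thesis by simp
  qed
  have Kne: "K \<noteq> {}" using ne BK by (auto simp: B_def)
  define m where "m = Inf (F ` K)"
  have bdd: "bdd_below (F ` K)" using F_nonneg by (rule bdd_belowI2)
  have m_le: "m \<le> F p" if "p \<in> K" for p
    unfolding m_def using that bdd by (intro cInf_lower) auto
  have m_nonneg: "0 \<le> m" unfolding m_def using Kne F_nonneg by (intro cInf_greatest) auto
  have "\<exists>p\<in>K. F p < m + 1 / (real n + 1)" for n
    using cInf_lessD[of "F ` K" "m + 1 / (real n + 1)"] Kne by (auto simp: m_def)
  then obtain p where pK: "\<And>n. p n \<in> K" and pF: "\<And>n. F (p n) < m + 1 / (real n + 1)"
    by metis
  have F_line: "F ((1 - t) *\<^sub>R x + t *\<^sub>R y) = F x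
      + t * ((q x \<bullet> (q y - q x)) / 2 + snd (snd y) - snd (snd x))
      + t\<^sup>2 * (((q y - q x) \<bullet> (q y - q x)) / 4)" for x y t
  proof -
    define d where "d = q y - q x"
    have "q ((1 - t) *\<^sub>R x + t *\<^sub>R y) = q x + t *\<^sub>R d"
      by (simp add: q_def d_def algebra_simps)
    hence "F ((1 - t) *\<^sub>R x + t *\<^sub>R y) = ((q x + t *\<^sub>R d) \<bullet> (q x + t *\<^sub>R d)) / 4
        + ((1 - t) * snd (snd x) + t * snd (snd y))"
      by (simp add: F_def)
    thus ?thesis unfolding d_def[symmetric]
      by (simp add: F_def inner_add_left inner_add_right inner_commute[of d "q x"]
          power2_eq_square field_simps)
  qed
  have F_mid: "(q x - q y) \<bullet> (q x - q y) / 8 \<le> (F x - m) + (F y - m)" if "x \<in> K" "y \<in> K" for x y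
  proof -
    have "(1 - 1/2) *\<^sub>R x + (1/2) *\<^sub>R y \<in> K" using Kconv that by (intro convexD) auto
    from m_le[OF this] show ?thesis unfolding F_line
      by (simp add: F_def inner_diff_left inner_diff_right inner_commute power2_eq_square field_simps)
  qed
  have F_lim: "(\<lambda>n. F (p n)) \<longlonglongrightarrow> m"
  proof (rule tendsto_sandwich[where f = "\<lambda>_. m" and h = "\<lambda>n. m + 1 / (real n + 1)"])
    show "(\<lambda>n. m + 1 / (real n + 1)) \<longlonglongrightarrow> m"
      using tendsto_add[OF tendsto_const[of m] LIMSEQ_inverse_real_of_nat]
      by (simp add: inverse_eq_divide add.commute)
  qed (use m_le pK pF in \<open>auto intro!: always_eventually less_imp_le\<close>)
  have "Cauchy (\<lambda>n. q (p n))"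
  proof (rule metric_CauchyI)
    fix \<epsilon> :: real assume "0 < \<epsilon>"
    hence "eventually (\<lambda>n. F (p n) < m + \<epsilon>\<^sup>2 / 16) sequentially"
      by (intro order_tendstoD(2)[OF F_lim]) simp
    then obtain n0 where n0: "\<And>n. n \<ge> n0 \<Longrightarrow> F (p n) < m + \<epsilon>\<^sup>2 / 16"
      by (auto simp: eventually_sequentially)
    have "dist (q (p i)) (q (p j)) < \<epsilon>" if "i \<ge> n0" "j \<ge> n0" for i j
    proof -
      have "(norm (q (p i) - q (p j)))\<^sup>2 < \<epsilon>\<^sup>2"
        using F_mid[OF pK pK, of i j] n0[OF that(1)] n0[OF that(2)] by (simp add: power2_norm_eq_inner)
      thus ?thesis using \<open>0 < \<epsilon>\<close> by (simp add: dist_norm power2_less_imp_less)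
    qed
    thus "\<exists>M. \<forall>i\<ge>M. \<forall>j\<ge>M. dist (q (p i)) (q (p j)) < \<epsilon>" by blast
  qed
  then obtain Q where Q: "(\<lambda>n. q (p n)) \<longlonglongrightarrow> Q"
    using Cauchy_convergent_iff convergent_def by blast
  have r_lim: "(\<lambda>n. snd (snd (p n))) \<longlonglongrightarrow> m - (Q \<bullet> Q) / 4"
  proof -
    have "(\<lambda>n. F (p n) - (q (p n) \<bullet> q (p n)) / 4) \<longlonglongrightarrow> m - (Q \<bullet> Q) / 4"
      by (intro tendsto_intros F_lim Q) auto
    thus ?thesis by (simp add: F_def)
  qed
  show thesis
  proof (rule that[of "(1/2) *\<^sub>R Q"])
    fix x v assume xv: "(x, v) \<in> A"
    define y where "y = (x, v, x \<bullet> v)"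
    have yK: "y \<in> K" using xv BK by (auto simp: B_def y_def)
    define S where "S = (Q \<bullet> (q y - Q)) / 2 + x \<bullet> v - m + (Q \<bullet> Q) / 4"
    define d where "d = ((q y - Q) \<bullet> (q y - Q)) / 4"
    \<comment> \<open>The points \<open>p n\<close> need not converge, but \<open>F_line\<close>
      involves only their values of q, F and the third coordinate, and these do.\<close>
    have step: "0 \<le> t * S + t\<^sup>2 * d" if t: "0 < t" "t \<le> 1" for t
    proof -
      have "m \<le> F (p n) + t * ((q (p n) \<bullet> (q y - q (p n))) / 2 + x \<bullet> v - snd (snd (p n)))
             + t\<^sup>2 * (((q y - q (p n)) \<bullet> (q y - q (p n))) / 4)" for n
      proof -
        have "(1 - t) *\<^sub>R p n + t *\<^sub>R y \<in> K" using Kconv that pK yK by (intro convexD) auto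
        from m_le[OF this] show ?thesis unfolding F_line by (simp add: y_def)
      qed
      moreover have "(\<lambda>n. F (p n) + t * ((q (p n) \<bullet> (q y - q (p n))) / 2 + x \<bullet> v - snd (snd (p n)))
             + t\<^sup>2 * (((q y - q (p n)) \<bullet> (q y - q (p n))) / 4))
           \<longlonglongrightarrow> m + t * ((Q \<bullet> (q y - Q)) / 2 + x \<bullet> v - (m - (Q \<bullet> Q) / 4))
             + t\<^sup>2 * (((q y - Q) \<bullet> (q y - Q)) / 4)"
        by (intro tendsto_intros F_lim Q r_lim) auto
      ultimately have "m \<le> m + t * ((Q \<bullet> (q y - Q)) / 2 + x \<bullet> v - (m - (Q \<bullet> Q) / 4))
             + t\<^sup>2 * (((q y - Q) \<bullet> (q y - Q)) / 4)"
        by (intro LIMSEQ_le_const) auto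
      thus ?thesis by (simp add: S_def d_def algebra_simps)
    qed
    have "0 \<le> S"
    proof (rule ccontr)
      assume "\<not> 0 \<le> S"
      hence S: "S < 0" by simp
      have d: "0 \<le> d" by (simp add: d_def)
      define t where "t = min 1 (- S / (2 * (d + 1)))"
      have t: "0 < t" "t \<le> 1" using S d by (auto simp: t_def field_simps)
      have "t \<le> - S / (2 * (d + 1))" by (simp add: t_def)
      hence "t * (d + 1) \<le> - S / 2" using d by (simp add: field_simps)
      hence "t * d + S < 0" using t S by (simp add: algebra_simps)
      hence "t * (t * d + S) < 0" using t by (simp add: mult_pos_neg)
      with step[OF t] show False by (simp add: power2_eq_square algebra_simps)
    qed
    \<comment> \<open>\<open>S\<close> contains - m, which may be dropped as m is nonnegative; what
      remains is the claimed inner product multiplied out.\<close>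
    hence "0 \<le> (Q \<bullet> (q y - Q)) / 2 + x \<bullet> v + (Q \<bullet> Q) / 4" using m_nonneg by (simp add: S_def)
    thus "0 \<le> (x - (1/2) *\<^sub>R Q) \<bullet> (v + (1/2) *\<^sub>R Q)"
      by (simp add: q_def y_def inner_add_left inner_add_right inner_diff_left inner_diff_right
              inner_commute field_simps)
  qed
qed

text \<open>A common point w for the graph of \<rho>T - y makes (w, (y - w)/\<rho>) monotonically
  related to the whole graph of T. Adding this pair keeps T monotone, so by maximality it was there
  already.\<close>

theorem Minty_surjective:
  fixes T :: "'a::{real_inner, complete_space} \<Rightarrow> 'a set"
  assumes T: "maximal_monotone_operator T" and ne: "v0 \<in> T x0" and \<rho>: "0 < \<rho>"
  obtains w v where "v \<in> T w" "y = w + \<rho> *\<^sub>R v"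
proof -
  have mono: "0 \<le> (x - x') \<bullet> (v - v')" if "v \<in> T x" "v' \<in> T x'" for x v x' v'
    using T that by (auto simp: maximal_monotone_operator_def monotone_operator_def)
  define A where "A = {(x, \<rho> *\<^sub>R v - y) | x v. v \<in> T x}"
  obtain w where w: "\<And>x v. (x, v) \<in> A \<Longrightarrow> 0 \<le> (x - w) \<bullet> (v + w)"
  proof (rule monotone_graph_common_point[of A])
    show "A \<noteq> {}" using ne by (auto simp: A_def)
    fix x v x' v' assume "(x, v) \<in> A" "(x', v') \<in> A"
    then obtain b b' where b: "b \<in> T x" "v = \<rho> *\<^sub>R b - y" "b' \<in> T x'" "v' = \<rho> *\<^sub>R b' - y"
      by (auto simp: A_def)
    have "(x - x') \<bullet> (v - v') = \<rho> * ((x - x') \<bullet> (b - b'))"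
      unfolding b(2,4) by (simp add: inner_diff_right algebra_simps)
    thus "0 \<le> (x - x') \<bullet> (v - v')" using mono[OF b(1,3)] \<rho> by simp
  qed (rule that)
  define b where "b = (1 / \<rho>) *\<^sub>R (y - w)"
  have yb: "y = w + \<rho> *\<^sub>R b" using \<rho> by (simp add: b_def)
  have wb: "0 \<le> (x - w) \<bullet> (v - b)" if "v \<in> T x" for x v
  proof -
    have "0 \<le> (x - w) \<bullet> (\<rho> *\<^sub>R v - y + w)" using w that by (auto simp: A_def)
    also have "\<rho> *\<^sub>R v - y + w = \<rho> *\<^sub>R (v - b)" using yb by (simp add: algebra_simps)
    finally show ?thesis using \<rho> by (simp add: zero_le_mult_iff)
  qed
  define T' where "T' = (\<lambda>x. if x = w then insert b (T w) else T x)"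
  have "0 \<le> (x - x') \<bullet> (v - v')" if "v \<in> T' x" "v' \<in> T' x'" for x x' v v'
  proof -
    have "v \<in> T x \<or> (x = w \<and> v = b)" "v' \<in> T x' \<or> (x' = w \<and> v' = b)"
      using that by (auto simp: T'_def split: if_splits)
    moreover have "0 \<le> (w - x) \<bullet> (b - v)" if "v \<in> T x" for x v
      using wb[OF that] by (metis inner_minus_left inner_minus_right minus_diff_eq minus_minus)
    ultimately show ?thesis using mono wb by auto
  qed
  hence "monotone_operator T'" by (auto simp: monotone_operator_def)
  moreover have "\<forall>x. T x \<subseteq> T' x" by (auto simp: T'_def)
  ultimately have "T' = T" using T by (auto simp: maximal_monotone_operator_def)
  hence "b \<in> T w" by (metis T'_def insertI1)
  thus thesis using yb that by blast
qed

section \<open>Resolvents of a maximal monotone operator\<close>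

lemma resolvent_unique:
  assumes T: "monotone_operator T" and \<rho>: "0 < \<rho>" and v: "v \<in> T w"
  shows "resolvent T \<rho> (w + \<rho> *\<^sub>R v) = w"
  unfolding resolvent_def
proof (rule the_equality)
  fix w' assume "w + \<rho> *\<^sub>R v \<in> (\<lambda>v. w' + \<rho> *\<^sub>R v) ` T w'"
  then obtain v' where v': "v' \<in> T w'" "w + \<rho> *\<^sub>R v = w' + \<rho> *\<^sub>R v'" by auto
  have "0 \<le> \<rho> * ((w - w') \<bullet> (v - v'))" using T v v' \<rho> by (auto simp: monotone_operator_def)
  also have "\<dots> = (w - w') \<bullet> (\<rho> *\<^sub>R v - \<rho> *\<^sub>R v')" by (simp add: inner_diff_right algebra_simps)
  also have "\<rho> *\<^sub>R v - \<rho> *\<^sub>R v' = - (w - w')" using v'(2) by (simp add: algebra_simps)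
  finally have "(w - w') \<bullet> (w - w') \<le> 0" by (simp del: minus_diff_eq)
  thus "w' = w" by (metis inner_ge_zero inner_eq_zero_iff order_antisym right_minus_eq)
qed (use v in auto)

locale maximal_monotone =
  fixes T :: "'a::{real_inner, complete_space} \<Rightarrow> 'a set" and s :: 'a
  assumes T: "maximal_monotone_operator T" and s: "s \<in> zeros T"
begin

lemma resolvent_mem:
  assumes "0 < \<rho>"
  obtains v where "v \<in> T (resolvent T \<rho> x)" "x = resolvent T \<rho> x + \<rho> *\<^sub>R v"
proof -
  have "0 \<in> T s" using s by (simp add: zeros_def)
  then obtain w v where "v \<in> T w" "x = w + \<rho> *\<^sub>R v"
    using Minty_surjective[OF T _ assms] by blast
  thus thesis using that resolvent_unique[of T \<rho> v w] T assms
    by (auto simp: maximal_monotone_operator_def)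
qed

lemma resolvent_fixed:
  assumes "0 < \<rho>" shows "resolvent T \<rho> s = s"
  using resolvent_unique[of T \<rho> 0 s] T s assms by (auto simp: maximal_monotone_operator_def zeros_def)

lemma resolvent_nonexpansive:
  assumes "0 < \<rho>"
  shows "norm (resolvent T \<rho> x - resolvent T \<rho> y) \<le> norm (x - y)"
proof -
  define p q where "p = resolvent T \<rho> x" and "q = resolvent T \<rho> y"
  obtain v where v: "v \<in> T p" "x = p + \<rho> *\<^sub>R v" using resolvent_mem[OF assms] p_def by blast
  obtain w where w: "w \<in> T q" "y = q + \<rho> *\<^sub>R w" using resolvent_mem[OF assms] q_def by blast
  have "0 \<le> (p - q) \<bullet> (v - w)"
    using T v w by (auto simp: maximal_monotone_operator_def monotone_operator_def)
  hence "0 \<le> \<rho> * ((p - q) \<bullet> (v - w))" using assms by simp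
  hence "(p - q) \<bullet> (p - q) \<le> (p - q) \<bullet> (x - y)"
    unfolding v(2) w(2) by (simp add: inner_add_right inner_diff_right algebra_simps)
  also have "\<dots> \<le> norm (p - q) * norm (x - y)" by (rule norm_cauchy_schwarz)
  finally have "norm (p - q) * norm (p - q) \<le> norm (p - q) * norm (x - y)"
    by (simp add: power2_norm_eq_inner flip: power2_eq_square)
  thus ?thesis unfolding p_def q_def by (cases "norm (p - q) = 0") (auto simp: p_def q_def)
qed

text \<open>If v lies in T p and x = p + \<rho> v, then p is also the \<sigma>-resolvent of p +
  \<sigma> v. So a change of parameter amounts to a change of argument by (1 - \<sigma>/\<rho>)(x -
  p), to which nonexpansiveness applies.\<close>

lemma resolvent_change:
  assumes "0 < \<rho>" "0 < \<sigma>"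
  shows "norm (resolvent T \<sigma> x - resolvent T \<rho> x) \<le> \<bar>1 - \<sigma> / \<rho>\<bar> * norm (x - resolvent T \<rho> x)"
proof -
  define p where "p = resolvent T \<rho> x"
  obtain v where v: "v \<in> T p" "x = p + \<rho> *\<^sub>R v" using resolvent_mem[OF assms(1)] p_def by blast
  have "resolvent T \<sigma> (p + \<sigma> *\<^sub>R v) = p"
    using resolvent_unique[of T \<sigma> v p] v T assms by (auto simp: maximal_monotone_operator_def)
  hence "norm (resolvent T \<sigma> x - p) \<le> norm (x - (p + \<sigma> *\<^sub>R v))"
    using resolvent_nonexpansive[OF assms(2), of x "p + \<sigma> *\<^sub>R v"] by simp
  also have "x - (p + \<sigma> *\<^sub>R v) = (1 - \<sigma> / \<rho>) *\<^sub>R (x - p)"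
    using assms(1) unfolding v(2) by (simp add: algebra_simps)
  finally show ?thesis by (simp add: p_def)
qed

end

section \<open>A quantitative Suzuki lemma\<close>

text \<open>While |w - z| stays close to its value at m and w moves hardly more than z, the steps of
  z add up without cancelling, so \<open>z (m - j)\<close> is far from \<open>w m\<close>. For many
  steps and small \<epsilon> this contradicts boundedness. The factor \<open>a ^ j\<close> comes
  from one division by gam \<ge> 1/a per backward step.\<close>

lemma Suzuki_backward:
  fixes z w :: "nat \<Rightarrow> 'a::real_normed_vector" and a :: nat
  assumes gam: "\<And>i. 1 / real a \<le> gam i" "\<And>i. gam i < 1" and a: "0 < a"
    and conv: "\<And>i. z (Suc i) = gam i *\<^sub>R z i + (1 - gam i) *\<^sub>R w i"
    and \<epsilon>: "0 \<le> \<epsilon>" and d: "0 \<le> d"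
    and bound: "\<And>i. m \<le> i + t \<Longrightarrow> i < m \<Longrightarrow> norm (w i - z i) \<le> d + \<epsilon>"
    and near: "\<And>i. m \<le> i + t \<Longrightarrow> i < m \<Longrightarrow>
      norm (w (Suc i) - w i) \<le> norm (z (Suc i) - z i) + \<epsilon>"
    and top: "d \<le> norm (w m - z m)"
    and "j \<le> t" "j \<le> m"
  shows "(1 + (\<Sum>i=m-j..<m. 1 - gam i)) * d - real (j * (2 * j + 1) * a ^ j) * \<epsilon>
     \<le> norm (w m - z (m - j))"
  using \<open>j \<le> t\<close> \<open>j \<le> m\<close>
proof (induction j)
  case 0
  thus ?case using top by simp
next
  case (Suc j)
  define q where "q = m - Suc j"
  have q: "m - j = Suc q" "q < m" "m \<le> q + t" "m - q = Suc j" using Suc.prems by (auto simp: q_def)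
  define S where "S = (\<Sum>i=Suc q..<m. 1 - gam i)"
  define \<alpha> where "\<alpha> = gam q"
  define Cj where "Cj = real (j * (2 * j + 1) * a ^ j)"
  define X where "X = norm (w m - z q)"
  have \<alpha>: "1 / real a \<le> \<alpha>" "\<alpha> < 1" using gam by (auto simp: \<alpha>_def)
  have \<alpha>0: "0 < \<alpha>" using \<alpha>(1) a by (meson divide_pos_pos less_le_trans of_nat_0_less_iff zero_less_one)
  have S_Suc: "(\<Sum>i=q..<m. 1 - gam i) = (1 - \<alpha>) + S"
    unfolding S_def \<alpha>_def using q(2) by (simp add: sum.atLeast_Suc_lessThan)
  have gam_pos: "0 \<le> gam i" for i using gam(1)[of i] by (meson order_trans divide_nonneg_nonneg of_nat_0_le_iff zero_le_one)
  have S_le: "(1 - \<alpha>) + S \<le> Suc j"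
  proof -
    have "(\<Sum>i=q..<m. 1 - gam i) \<le> (\<Sum>i=q..<m. 1)" using gam_pos by (intro sum_mono) simp
    thus ?thesis using q(4) by (simp add: S_Suc)
  qed
  have IH: "(1 + S) * d - Cj * \<epsilon> \<le> norm (w m - z (Suc q))"
    using Suc by (simp add: q(1) S_def Cj_def)
  have "norm (w m - w q) \<le> (\<Sum>i=q..<m. norm (w (Suc i) - w i))"
    using norm_sum[of "\<lambda>i. w (Suc i) - w i" "{q..<m}"] q(2) by (simp add: sum_Suc_diff')
  also have "\<dots> \<le> (\<Sum>i=q..<m. (1 - gam i) * (d + \<epsilon>) + \<epsilon>)"
  proof (intro sum_mono)
    fix i assume "i \<in> {q..<m}"
    hence i: "m \<le> i + t" "i < m" using q by auto
    have "z (Suc i) - z i = (1 - gam i) *\<^sub>R (w i - z i)" by (simp add: conv algebra_simps)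
    hence "norm (z (Suc i) - z i) = (1 - gam i) * norm (w i - z i)" using gam(2)[of i] by simp
    also have "\<dots> \<le> (1 - gam i) * (d + \<epsilon>)"
      using bound[OF i] gam(2)[of i] by (intro mult_left_mono) auto
    finally show "norm (w (Suc i) - w i) \<le> (1 - gam i) * (d + \<epsilon>) + \<epsilon>" using near[OF i] by simp
  qed
  also have "\<dots> = ((1 - \<alpha>) + S) * (d + \<epsilon>) + Suc j * \<epsilon>"
    by (simp add: sum.distrib q(4) S_Suc flip: sum_distrib_right)
  also have "\<dots> \<le> ((1 - \<alpha>) + S) * d + 2 * Suc j * \<epsilon>"
    using mult_right_mono[OF S_le \<epsilon>] by (simp add: algebra_simps)
  finally have wq: "norm (w m - w q) \<le> ((1 - \<alpha>) + S) * d + 2 * Suc j * \<epsilon>" .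
  have "w m - z (Suc q) = \<alpha> *\<^sub>R (w m - z q) + (1 - \<alpha>) *\<^sub>R (w m - w q)"
    by (simp add: conv \<alpha>_def algebra_simps)
  hence "norm (w m - z (Suc q)) \<le> \<alpha> * X + (1 - \<alpha>) * norm (w m - w q)"
    using norm_triangle_ineq[of "\<alpha> *\<^sub>R (w m - z q)" "(1 - \<alpha>) *\<^sub>R (w m - w q)"] \<alpha> \<alpha>0 by (simp add: X_def)
  also have "\<dots> \<le> \<alpha> * X + ((1 - \<alpha>) * (((1 - \<alpha>) + S) * d) + 2 * Suc j * \<epsilon>)"
  proof -
    have "(1 - \<alpha>) * norm (w m - w q) \<le> (1 - \<alpha>) * (((1 - \<alpha>) + S) * d + 2 * Suc j * \<epsilon>)"
      using wq \<alpha> by (intro mult_left_mono) auto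
    moreover have "(1 - \<alpha>) * (2 * Suc j * \<epsilon>) \<le> 1 * (2 * Suc j * \<epsilon>)"
      using \<alpha>0 \<epsilon> by (intro mult_right_mono) auto
    ultimately show ?thesis by (simp add: algebra_simps)
  qed
  finally have "(1 + S) * d - Cj * \<epsilon> \<le> \<alpha> * X + ((1 - \<alpha>) * (((1 - \<alpha>) + S) * d) + 2 * Suc j * \<epsilon>)"
    using IH by linarith
  \<comment> \<open>With A = (1 - \<alpha>) + S one has (1 + S) - (1 - \<alpha>) A = \<alpha> (1 +
    A): the new coefficient of d appears with the same factor \<alpha> as X.\<close>
  hence main: "\<alpha> * ((1 + ((1 - \<alpha>) + S)) * d - X) \<le> (Cj + 2 * Suc j) * \<epsilon>"
    by (simp add: algebra_simps)
  have "(1 + ((1 - \<alpha>) + S)) * d - X \<le> a * ((Cj + 2 * Suc j) * \<epsilon>)"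
  proof (cases "0 \<le> (1 + ((1 - \<alpha>) + S)) * d - X")
    case True
    hence "1 / real a * ((1 + ((1 - \<alpha>) + S)) * d - X) \<le> (Cj + 2 * Suc j) * \<epsilon>"
      using mult_right_mono[OF \<alpha>(1) True] main by linarith
    thus ?thesis using a by (simp add: field_simps)
  next
    case False
    moreover have "0 \<le> a * ((Cj + 2 * Suc j) * \<epsilon>)" using \<epsilon> by (simp add: Cj_def)
    ultimately show ?thesis by linarith
  qed
  \<comment> \<open>The coefficients of \<epsilon> absorb the new term because j (2j + 1) + 2 (j +
    1) \<le> (j + 1)(2j + 3).\<close>
  also have "\<dots> \<le> real (Suc j * (2 * Suc j + 1) * a ^ Suc j) * \<epsilon>"
  proof -
    have "1 \<le> a ^ j" using a by (simp add: Suc_leI)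
    hence "j * (2 * j + 1) * a ^ j + 2 * Suc j * 1 \<le> j * (2 * j + 1) * a ^ j + 2 * Suc j * a ^ j"
      by (intro add_left_mono mult_left_mono) auto
    also have "\<dots> \<le> (Suc j * (2 * Suc j + 1)) * a ^ j"
      unfolding add_mult_distrib[symmetric] by (intro mult_right_mono) auto
    finally have "a * (j * (2 * j + 1) * a ^ j + 2 * Suc j) \<le> Suc j * (2 * Suc j + 1) * a ^ Suc j"
      by (metis mult.right_neutral mult.left_commute mult_le_mono2 power_Suc)
    hence "real a * (Cj + 2 * Suc j) \<le> real (Suc j * (2 * Suc j + 1) * a ^ Suc j)"
      unfolding Cj_def by (metis of_nat_add of_nat_le_iff of_nat_mult of_nat_numeral)
    thus ?thesis using \<epsilon> mult_right_mono by (fastforce simp: mult.assoc[symmetric])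
  qed
  finally show ?case by (simp add: q_def[symmetric] S_Suc X_def)
qed

text \<open>The windows [st j, en j] increase with j, and the window with index j + 1 contains [n, n + f n] for
  n = en j.  If the conclusion failed for all these n, the maxima of |w - z| over the windows would be
  bounded below and, being at most b, could not grow by more than 1/R at each of the P steps.  At a step
  without such growth the backward induction gives a contradiction.\<close>

lemma Suzuki_metastable:
  fixes z w :: "nat \<Rightarrow> 'a::real_normed_vector" and a b k t M R :: nat and f :: "nat \<Rightarrow> nat"
  assumes gam: "\<And>i. 1 / real a \<le> gam i" "\<And>i. gam i \<le> 1 - 1 / real a" and a: "0 < a"
    and conv: "\<And>i. z (Suc i) = gam i *\<^sub>R z i + (1 - gam i) *\<^sub>R w i"
    and near: "\<And>i. M \<le> i \<Longrightarrow> norm (w (Suc i) - w i) \<le> norm (z (Suc i) - z i) + 1 / real R"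
    and bound: "\<And>i j. norm (w i - z j) \<le> real b"
    and b: "0 < b" and t: "b * a * (k + 1) \<le> t"
    and R: "R = t * (2 * t + 1) * a ^ t * (k + 1)"
  shows "\<exists>n \<le> M + theta_r M t (b * R) (\<lambda>m. t + f m) (b * R).
           \<forall>i\<in>{n..n + f n}. norm (w i - z i) \<le> 1 / (real k + 1)"
proof (rule ccontr)
  define P where "P = b * R"
  define r where "r = theta_r M t P (\<lambda>m. t + f m)"
  assume "\<not> ?thesis"
  hence ex: "\<exists>i\<in>{n..n + f n}. 1 / (real k + 1) < norm (w i - z i)" if "n \<le> M + r P" for n
    using that unfolding r_def P_def by (meson not_le)
  have t0: "0 < t" using t a b by (metis add_gr_0 less_le_trans nat_0_less_mult_iff zero_less_one)
  have C1: "1 \<le> t * (2 * t + 1) * a ^ t" using t0 a by (simp add: Suc_leI)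
  \<comment> \<open>R is made so that the accumulated error of t backward steps is exactly 1/(k +
    1).\<close>
  hence C_eq: "real (t * (2 * t + 1) * a ^ t) * (1 / real R) = 1 / (real k + 1)"
  proof -
    have "real Q * (1 / real (Q * (k + 1))) = 1 / (real k + 1)" if "1 \<le> Q" for Q :: nat
      using that unfolding of_nat_mult of_nat_add by simp
    from this[OF C1] show ?thesis unfolding R .
  qed
  from C1 have R0: "k + 1 \<le> R" using mult_le_mono1[of 1 _ "k + 1"] unfolding R by fastforce
  hence "0 < R" by simp
  note R0 = R0 this
  have P0: "0 < P" using R0 b by (simp add: P_def)
  have R1: "1 / real R \<le> 1 / (real k + 1)" using R0 by (intro divide_left_mono) auto
  \<comment> \<open>Indices count the distance to P, as in \<open>theta_r\<close>. Window j + 1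
    starts t before window j, room for the backward induction, and ends t + f (en j) after it, room
    for the assumed counterexample at n = en j.\<close>
  define st where "st j = M + (P - j) * t" for j
  define en where "en j = st j + r j" for j
  have r_Suc: "r (Suc j) = t + r j + (t + f (en j))" for j by (simp add: r_def en_def st_def)
  have st_Suc: "st (Suc j) + t = st j" if "j < P" for j
  proof -
    have "P - j = Suc (P - Suc j)" using that by simp
    thus ?thesis by (simp add: st_def)
  qed
  have en_Suc: "en (Suc j) = en j + t + f (en j)" if "j < P" for j
    using st_Suc[OF that] by (simp add: en_def[of "Suc j"] r_Suc) (simp add: en_def)
  have en_le: "en j \<le> M + r P" if "j \<le> P" for j
  proof -
    have "en j \<le> en P" using that
    proof (induction rule: inc_induct)
      case (step n)
      thus ?case using en_Suc[of n] by linarith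
    qed simp
    thus ?thesis by (simp add: en_def st_def)
  qed
  define x where "x i = norm (w i - z i)" for i
  define v where "v j = Max (x ` {st j..en j})" for j
  have st_en: "st j \<le> en j" for j by (simp add: en_def)
  have x_le: "x i \<le> v j" if "st j \<le> i" "i \<le> en j" for i j
    unfolding v_def using that by (intro Max_ge) auto
  have v_att: "\<exists>i. st j \<le> i \<and> i \<le> en j \<and> x i = v j" for j
  proof -
    have "v j \<in> x ` {st j..en j}" unfolding v_def using st_en by (intro Max_in) auto
    thus ?thesis by auto
  qed
  have v_gt: "1 / (real k + 1) < v (Suc j)" if "j < P" for j
  proof -
    obtain i where i: "en j \<le> i" "i \<le> en j + f (en j)" "1 / (real k + 1) < x i"
      using ex[OF en_le[of j]] \<open>j < P\<close> by (auto simp: x_def)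
    have "st (Suc j) \<le> i" using st_Suc[OF that] st_en[of j] i by linarith
    hence "x i \<le> v (Suc j)" using i en_Suc[OF that] by (intro x_le) auto
    thus ?thesis using i by linarith
  qed
  \<comment> \<open>The count starts at 1, as \<open>v_gt\<close> says nothing about window 0. If
    every step gained more than 1/R, then v P would exceed P/R = b.\<close>
  have "\<exists>j. 1 \<le> j \<and> j < P \<and> v (Suc j) \<le> v j + 1 / R"
  proof (rule ccontr)
    assume "\<not> ?thesis"
    hence step: "v j + 1 / R < v (Suc j)" if "1 \<le> j" "j < P" for j using that by force
    have "real j / R < v j" if "1 \<le> j" "j \<le> P" for j
      using that
    proof (induction j rule: nat_induct_at_least)
      case base
      thus ?case using v_gt[of 0] P0 R1 by simp
    next
      case (Suc n)
      thus ?case using step[of n] by (simp add: add_divide_distrib)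
    qed
    from this[of P] have "real b < v P" using P0 R0 by (simp add: P_def)
    thus False using v_att[of P] bound by (metis leD x_def)
  qed
  then obtain j where j: "1 \<le> j" "j < P" "v (Suc j) \<le> v j + 1 / R" by blast
  obtain m where m: "st j \<le> m" "m \<le> en j" "x m = v j" using v_att by blast
  have st_m: "st (Suc j) + t \<le> m" using st_Suc[OF j(2)] m by simp
  have M: "M \<le> st (Suc j)" by (simp add: st_def)
  have vj: "1 / (real k + 1) < v j" using v_gt[of "j - 1"] j by simp
  \<comment> \<open>The maximum over window j is attained at m, and the t indices below m still lie
    in window j + 1, where |w - z| is at most v j + 1/R.\<close>
  have "(1 + (\<Sum>i=m-t..<m. 1 - gam i)) * v j - real (t * (2 * t + 1) * a ^ t) * (1 / R)
     \<le> norm (w m - z (m - t))"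
  proof (rule Suzuki_backward[where a = a])
    show "gam i < 1" for i using gam(2)[of i] a by (smt (verit) divide_pos_pos of_nat_0_less_iff)
    show "0 \<le> v j" using vj by (smt (verit) divide_nonneg_nonneg of_nat_0_le_iff)
    fix i assume i: "m \<le> i + t" "i < m"
    have "x i \<le> v (Suc j)" using i st_m m en_Suc[OF j(2)] by (intro x_le) auto
    thus "norm (w i - z i) \<le> v j + 1 / R" using j by (simp add: x_def)
    show "norm (w (Suc i) - w i) \<le> norm (z (Suc i) - z i) + 1 / R"
      using i st_m M by (intro near) auto
  qed (use gam a conv m st_m in \<open>auto simp: x_def\<close>)
  also have "\<dots> \<le> b" by (rule bound)
  finally have le: "(1 + (\<Sum>i=m-t..<m. 1 - gam i)) * v j - 1 / (real k + 1) \<le> b"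
    unfolding C_eq .
  \<comment> \<open>The sum is at least t/a \<ge> b (k + 1) and v j > 1/(k + 1), so their product
    already reaches b; the surplus v j - 1/(k + 1) > 0 contradicts \<open>le\<close>.\<close>
  have "real t / a = (\<Sum>i=m-t..<m. 1 / real a)" using st_m by simp
  also have "\<dots> \<le> (\<Sum>i=m-t..<m. 1 - gam i)" using gam(2) by (intro sum_mono) (simp add: algebra_simps)
  finally have S: "real t / a \<le> (\<Sum>i=m-t..<m. 1 - gam i)" .
  have "real (b * a * (k + 1)) \<le> real t" using t by (simp only: of_nat_le_iff)
  hence "real b * (real a * (real k + 1)) \<le> real t" by (simp add: algebra_simps)
  hence "real b \<le> real t / (real a * (real k + 1))" using a by (subst pos_le_divide_eq) auto
  hence "real b \<le> real t / a * (1 / (real k + 1))" by simp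
  also have "\<dots> \<le> (\<Sum>i=m-t..<m. 1 - gam i) * v j"
    using S vj a by (intro mult_mono) (auto intro: order_trans[rotated])
  finally show False using le vj by (simp add: algebra_simps)
qed

section \<open>Monotonicity of the functionals\<close>

text \<open>Both recursions are compared at the same distance j from their ends P and P'.
  Monotonicity of the majorant gives g m \<le> g' m \<le> g' m' whenever m \<le> m'.\<close>

lemma theta_r_mono:
  assumes "M \<le> M'" "t \<le> t'" "P \<le> P'" "\<And>m. g m \<le> g' m" "mono g'" "j \<le> j'"
  shows "theta_r M t P g j \<le> theta_r M' t' P' g' j'"
proof -
  have "theta_r M t P g j \<le> theta_r M' t' P' g' j"
  proof (induction j)
    case (Suc j)
    have "(P - j) * t \<le> (P' - j) * t'" using assms by (intro mult_le_mono) auto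
    hence "M + (P - j) * t + theta_r M t P g j \<le> M' + (P' - j) * t' + theta_r M' t' P' g' j"
      using Suc assms(1) by linarith
    hence "g (M + (P - j) * t + theta_r M t P g j) \<le> g' (M' + (P' - j) * t' + theta_r M' t' P' g' j)"
      using assms(4) monoD[OF assms(5)] order_trans by blast
    thus ?case using Suc assms(2) by simp
  qed simp
  also have "\<dots> \<le> theta_r M' t' P' g' j'"
    using \<open>j \<le> j'\<close> by (rule lift_Suc_mono_le[rotated]) simp
  finally show ?thesis .
qed

lemma theta_mono:
  assumes "K \<le> K'" "M \<le> M'" "t \<le> t'" "\<And>m. g m \<le> g' m" "mono g'"
  shows "theta K M t B g \<le> theta K' M' t' B g'"
proof -
  have P: "B * (K + 1) \<le> B * (K' + 1)" using assms(1) by (intro mult_le_mono2) simp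
  have "(B * (K + 1) - 1) * t \<le> (B * (K' + 1) - 1) * t'"
    by (intro mult_le_mono diff_le_mono P assms)
  moreover have "theta_r M t (B * (K + 1)) g (B * (K + 1)) \<le> theta_r M' t' (B * (K' + 1)) g' (B * (K' + 1))"
    using assms P by (intro theta_r_mono)
  ultimately show ?thesis using assms(2) by (simp only: theta_def Let_def)
qed

locale mono_rate_data = rate_data +
  assumes a: "0 < a" and mono_data: "mono \<l>" "mono \<Gamma>" "mono E"
begin

lemma \<mu>_mono: "k \<le> k' \<Longrightarrow> \<mu> k \<le> \<mu> k'"
  unfolding \<mu>_def by (intro max.mono add_mono monoD[OF mono_data(1)] monoD[OF mono_data(3)] mult_le_mono) auto

lemma \<nu>_mono: "k \<le> k' \<Longrightarrow> \<nu> k \<le> \<nu> k'"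
proof -
  assume "k \<le> k'"
  moreover have "\<nu> k = max (\<Gamma> (10 * a * c * N0 * (k + 1)))
      (max (\<l> (10 * a * (N0 + N1 + N3) * (k + 1))) (E (5 * a * (k + 1)) + 1))" for k
    by (simp add: \<nu>_def)
  ultimately show ?thesis
    by (auto simp only: intro!: max.mono add_mono mult_le_mono
        monoD[OF mono_data(1)] monoD[OF mono_data(2)] monoD[OF mono_data(3)])
qed

lemma tt_mono: "k \<le> k' \<Longrightarrow> tt k \<le> tt k'"
  unfolding tt_def by (intro max.mono mult_le_mono) auto

lemma RR_mono: "k \<le> k' \<Longrightarrow> RR k \<le> RR k'"
  unfolding RR_def using tt_mono[of k k'] a
  by (intro mult_le_mono add_mono power_increasing) auto

lemma \<chi>0_mono:
  assumes "k \<le> k'" "\<And>m. f m \<le> f' m" "mono f'"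
  shows "\<chi>0 k f \<le> \<chi>0 k' f'"
  unfolding \<chi>0_def
proof (rule theta_mono)
  show "RR k - 1 \<le> RR k' - 1" using RR_mono[OF assms(1)] by simp
  thus "max a (\<nu> (RR k - 1)) \<le> max a (\<nu> (RR k' - 1))" using \<nu>_mono by (intro max.mono) auto
  show "tt k \<le> tt k'" by (rule tt_mono) fact
  thus "tt k + f m \<le> tt k' + f' m" for m using assms(2) by (rule add_mono)
  show "mono (\<lambda>m. tt k' + f' m)" using assms(3) by (simp add: mono_def)
qed

text \<open>The projection argument stops at a level of which only an upper bound is known in
  advance; this lets the bound replace the level.\<close>

lemma \<xi>_mono:
  assumes "k \<le> k'" "mono f"
  shows "\<xi> k f \<le> \<xi> k' f"
  unfolding \<xi>_def
proof (intro max.mono \<mu>_mono \<chi>0_mono)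
  fix m
  have le: "\<mu> (2 * k + 1) \<le> \<mu> (2 * k' + 1)" using assms(1) by (intro \<mu>_mono) simp
  thus "f_tilde (2 * k + 1) f m \<le> f_tilde (2 * k' + 1) f m"
    unfolding f_tilde_def by (intro add_mono monoD[OF assms(2)] max.mono) auto
  show "mono (f_tilde (2 * k' + 1) f)"
    unfolding f_tilde_def by (intro monoI add_mono monoD[OF assms(2)] max.mono) auto
qed (use assms in auto)

end

section \<open>Metastable asymptotic regularity\<close>

lemma norm_diff_le:
  fixes x y s :: "'a::real_normed_vector"
  shows "norm (x - y) \<le> norm (x - s) + norm (y - s)"
  using norm_triangle_ineq4[of "x - s" "y - s"] by simp

lemma inverse_of_nat_le:
  assumes "0 < X" shows "1 / (real X + 1) \<le> 1 / real X"
  using assms by (simp add: field_simps)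

locale halpern_ppa =
  mono_rate_data a c \<l> L \<Gamma> E \<C> N1 N2 N3 + maximal_monotone T s
  for a c :: nat and \<l> L \<Gamma> E \<C> :: "nat \<Rightarrow> nat" and N1 N2 N3 :: nat
    and T :: "'a::{real_inner, complete_space} \<Rightarrow> 'a set" and s :: 'a +
  fixes u :: 'a and z e :: "nat \<Rightarrow> 'a" and cs lam gam del :: "nat \<Rightarrow> real"
  assumes cs_pos: "0 < cs n"
    and lam: "0 < lam n" "lam n < 1"
    and gam: "0 < gam n"
    and del: "0 < del n"
    and sum1: "lam n + gam n + del n = 1"
    and z_Suc: "z (Suc n) =
      lam n *\<^sub>R u + gam n *\<^sub>R z n + del n *\<^sub>R resolvent T (cs n) (z n) + e n"
    and c: "0 < c"
    and L: "mono L" and \<C>: "mono \<C>"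
    and Q1: "\<l> k \<le> n \<Longrightarrow> lam n \<le> 1 / (real k + 1)"
    and Q2: "real k \<le> (\<Sum>i=1..L k. lam i)"
    and Q3: "1 / real a \<le> gam m" "gam m \<le> 1 - 1 / real a"
    and Q4: "1 / real c \<le> cs n"
    and Q5: "\<Gamma> k \<le> n \<Longrightarrow> \<bar>cs (n + 1) - cs n\<bar> \<le> 1 / (real k + 1)"
    and Q6: "(\<Sum>i=E k + 1..E k + n. norm (e i)) \<le> 1 / (real k + 1)"
    and cs_le: "cs n \<le> real (\<C> n)"
    and N2: "(\<Sum>i=0..E 0. norm (e i)) + 1 \<le> real N2"
    and N3: "norm (u - s) \<le> real N3" "norm (z 0 - s) \<le> real N3"
begin

abbreviation Jz :: "nat \<Rightarrow> 'a" where "Jz n \<equiv> resolvent T (cs n) (z n)"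

text \<open>Puts the iteration into the Krasnoselskii-Mann form z (n + 1) = gam z + (1 - gam) w that
  Suzuki's lemma treats; anchor and error are absorbed in w.\<close>

definition w :: "nat \<Rightarrow> 'a" where "w n = (1 / (1 - gam n)) *\<^sub>R (z (Suc n) - gam n *\<^sub>R z n)"

lemma N2_pos: "1 \<le> N2"
  using N2 sum_nonneg[of "{0..E 0}" "\<lambda>i. norm (e i)"] by simp

lemma N0_pos: "1 \<le> N0" using N2_pos by (simp add: N0_def)

lemma N_pos: "1 \<le> N" using N2_pos by (simp add: N_def)

lemma N0_le_N: "N0 \<le> N" by (simp add: N0_def N_def)

lemma Jz_near_s: "norm (Jz n - s) \<le> norm (z n - s)"
  using resolvent_nonexpansive[OF cs_pos[of n], of "z n" s] resolvent_fixed[OF cs_pos[of n]] by simp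

text \<open>u, z n and the resolvent of z n all lie in the ball around s whose radius is N3 plus the
  errors so far, and the weights add up to 1, so only the new error enlarges the ball. The errors
  after E 0 sum to at most 1, which is the summand 1 in the bound on N2.\<close>

lemma z_near_s: "norm (z n - s) \<le> real N0"
proof -
  have le: "norm (z n - s) \<le> N3 + (\<Sum>i<n. norm (e i))" for n
  proof (induction n)
    case (Suc n)
    have "z (Suc n) - s = lam n *\<^sub>R (u - s) + gam n *\<^sub>R (z n - s) + del n *\<^sub>R (Jz n - s) + e n"
    proof -
      have "lam n *\<^sub>R s + gam n *\<^sub>R s + del n *\<^sub>R s = s"
        by (metis scaleR_left_distrib scaleR_one sum1)
      thus ?thesis unfolding z_Suc by (simp add: algebra_simps)
    qed
    also have "norm \<dots> \<le> norm (lam n *\<^sub>R (u - s)) + norm (gam n *\<^sub>R (z n - s))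
        + norm (del n *\<^sub>R (Jz n - s)) + norm (e n)"
      by (intro norm_triangle_mono order_refl)
    also have "\<dots> = lam n * norm (u - s) + gam n * norm (z n - s) + del n * norm (Jz n - s) + norm (e n)"
      using lam gam del by (simp add: less_imp_le abs_of_pos)
    also have "\<dots> \<le> lam n * (N3 + (\<Sum>i<n. norm (e i))) + gam n * (N3 + (\<Sum>i<n. norm (e i)))
        + del n * (N3 + (\<Sum>i<n. norm (e i))) + norm (e n)"
    proof (intro add_mono mult_left_mono order_refl)
      show "norm (u - s) \<le> N3 + (\<Sum>i<n. norm (e i))"
        using N3(1) sum_nonneg[of "{..<n}" "\<lambda>i. norm (e i)"] by simp
      show "norm (Jz n - s) \<le> N3 + (\<Sum>i<n. norm (e i))"
        using Jz_near_s[of n] Suc.IH by linarith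
    qed (use Suc lam gam del in \<open>auto intro: less_imp_le\<close>)
    also have "\<dots> = (lam n + gam n + del n) * (N3 + (\<Sum>i<n. norm (e i))) + norm (e n)"
      by (simp add: algebra_simps)
    finally show ?case by (simp add: sum1)
  qed (use N3 in simp)
  have "(\<Sum>i<n. norm (e i)) \<le> (\<Sum>i\<in>{0..E 0} \<union> {E 0 + 1..E 0 + n}. norm (e i))"
    by (intro sum_mono2) auto
  also have "\<dots> = (\<Sum>i=0..E 0. norm (e i)) + (\<Sum>i=E 0 + 1..E 0 + n. norm (e i))"
    by (intro sum.union_disjoint) auto
  also have "\<dots> \<le> N2" using N2 Q6[of 0 n] by simp
  finally show ?thesis using le[of n] by (simp add: N0_def)
qed

lemma e_small:
  assumes "E k + 1 \<le> n" shows "norm (e n) \<le> 1 / (real k + 1)"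
proof -
  have "norm (e n) \<le> (\<Sum>i=E k + 1..E k + n. norm (e i))"
    using assms by (intro member_le_sum) auto
  thus ?thesis using Q6[of k n] by linarith
qed

lemma gam_less_1: "gam n < 1"
  using Q3(2)[of n] a by (smt (verit) divide_pos_pos of_nat_0_less_iff)

lemma inverse_gam: "0 < 1 / (1 - gam n)" "1 / (1 - gam n) \<le> real a"
proof -
  show "0 < 1 / (1 - gam n)" using gam_less_1 by simp
  have "1 \<le> real a * (1 - gam n)" using Q3(2)[of n] a by (simp add: field_simps)
  thus "1 / (1 - gam n) \<le> real a" using gam_less_1[of n] by (simp add: divide_le_eq)
qed

lemma z_Suc_w: "z (Suc n) = gam n *\<^sub>R z n + (1 - gam n) *\<^sub>R w n"
  using gam_less_1[of n] by (simp add: w_def)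

text \<open>Since 1 - gam = lam + del, w differs from the resolvent value by (lam (u - Jz) + e) / (1
  - gam), and 1/(1 - gam) \<le> a.\<close>

lemma w_Jz:
  "norm (w n - Jz n) \<le> a * (lam n * (N0 + N3) + norm (e n))"
proof -
  have "w n = (1 / (1 - gam n)) *\<^sub>R (lam n *\<^sub>R (u - Jz n) + e n + (1 - gam n) *\<^sub>R Jz n)"
  proof -
    have "z (Suc n) - gam n *\<^sub>R z n = lam n *\<^sub>R (u - Jz n) + e n + (1 - gam n) *\<^sub>R Jz n"
    proof -
      have "1 - gam n = lam n + del n" using sum1[of n] by simp
      show ?thesis unfolding z_Suc \<open>1 - gam n = lam n + del n\<close> by (simp add: algebra_simps)
    qed
    thus ?thesis by (simp add: w_def)
  qed
  hence "w n - Jz n = (1 / (1 - gam n)) *\<^sub>R (lam n *\<^sub>R (u - Jz n) + e n)"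
    using gam_less_1[of n] by (simp add: scaleR_right_distrib)
  hence "norm (w n - Jz n) = (1 / (1 - gam n)) * norm (lam n *\<^sub>R (u - Jz n) + e n)"
    using gam_less_1[of n] by simp
  also have "\<dots> \<le> a * (lam n * (N0 + N3) + norm (e n))"
  proof (intro mult_mono inverse_gam)
    have "norm (u - Jz n) \<le> norm (u - s) + norm (Jz n - s)"
      by (rule norm_diff_le)
    also have "\<dots> \<le> N0 + N3" using Jz_near_s[of n] z_near_s[of n] N3(1) by simp
    finally have "norm (lam n *\<^sub>R (u - Jz n)) \<le> lam n * (N0 + N3)" using lam(1)[of n] by simp
    thus "norm (lam n *\<^sub>R (u - Jz n) + e n) \<le> lam n * (N0 + N3) + norm (e n)"
      by (rule norm_triangle_mono) simp
  qed auto
  finally show ?thesis .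
qed

text \<open>The change of argument costs |z (n + 1) - z n| by nonexpansiveness. The parameter
  changes relatively by at most c/X, multiplied by |z n - Jz n| \<le> 2 N0; hence the factor c N0 in
  \<open>\<nu>\<close>.\<close>

lemma Jz_Suc:
  assumes "\<nu> k \<le> n"
  shows "norm (Jz (Suc n) - Jz n) \<le> norm (z (Suc n) - z n) + 1 / (5 * (real k + 1))"
proof -
  have K: "0 < real k + 1" by simp
  define X where "X = 10 * a * c * N0 * (k + 1)"
  have X: "0 < X" using a c N0_pos by (simp add: X_def)
  have X_eq: "real X = 10 * real a * real c * real N0 * (real k + 1)"
    by (simp add: X_def algebra_simps)
  have "\<Gamma> X \<le> n" using assms by (simp add: \<nu>_def X_def)
  hence "\<bar>cs (n + 1) - cs n\<bar> \<le> 1 / real X" by (rule order_trans[OF Q5 inverse_of_nat_le[OF X]])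
  hence "\<bar>cs (n + 1) - cs n\<bar> / cs n \<le> (1 / real X) / (1 / real c)"
    using Q4[of n] c by (intro frac_le) auto
  moreover have "\<bar>1 - cs (Suc n) / cs n\<bar> = \<bar>cs (n + 1) - cs n\<bar> / cs n"
  proof -
    have "1 - cs (Suc n) / cs n = - ((cs (n + 1) - cs n) / cs n)"
      using cs_pos[of n] by (simp add: field_simps)
    thus ?thesis using cs_pos[of n] by (simp only: abs_minus_cancel abs_divide abs_of_pos)
  qed
  ultimately have r: "\<bar>1 - cs (Suc n) / cs n\<bar> \<le> c / real X" by simp
  have "norm (z n - Jz n) \<le> norm (z n - s) + norm (Jz n - s)"
    by (rule norm_diff_le)
  hence zJ: "norm (z n - Jz n) \<le> 2 * N0" using Jz_near_s[of n] z_near_s[of n] by simp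
  have "norm (resolvent T (cs (Suc n)) (z n) - Jz n) \<le> c / real X * (2 * N0)"
    using resolvent_change[OF cs_pos[of n] cs_pos[of "Suc n"], of "z n"] mult_mono[OF r zJ] by simp
  also have "\<dots> = 1 / (5 * real a * (real k + 1))"
    using c N0_pos by (simp add: X_eq)
  also have "\<dots> \<le> 1 / (5 * (real k + 1))"
    using a K by (intro divide_left_mono mult_right_mono) auto
  finally show ?thesis
    using resolvent_nonexpansive[OF cs_pos[of "Suc n"], of "z (Suc n)" "z n"]
      norm_triangle_ineq[of "Jz (Suc n) - resolvent T (cs (Suc n)) (z n)"
        "resolvent T (cs (Suc n)) (z n) - Jz n"] by simp
qed

lemma w_Jz_small:
  assumes "\<nu> k \<le> n"
  shows "norm (w n - Jz n) \<le> 3 / (10 * (real k + 1))"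
proof -
  define X where "X = 10 * a * (N0 + N1 + N3) * (k + 1)"
  have X: "0 < X" using a N0_pos by (simp add: X_def)
  have "\<l> X \<le> n" using assms by (simp add: \<nu>_def X_def)
  hence "lam n \<le> 1 / real X" by (rule order_trans[OF Q1 inverse_of_nat_le[OF X]])
  also have "\<dots> \<le> 1 / (10 * real a * (real N0 + real N3) * (real k + 1))"
  proof (rule frac_le)
    show "10 * real a * (real N0 + real N3) * (real k + 1) \<le> real X"
      unfolding X_def of_nat_mult of_nat_add of_nat_numeral of_nat_1
      by (intro mult_mono) auto
    show "0 < 10 * real a * (real N0 + real N3) * (real k + 1)" using a N0_pos by simp
  qed auto
  finally have "lam n * (N0 + N3) \<le> 1 / (10 * real a * (real N0 + real N3) * (real k + 1)) * (N0 + N3)"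
    by (intro mult_right_mono) auto
  also have "\<dots> = 1 / (10 * real a * (real k + 1))" using N0_pos by simp
  finally have l: "lam n * (N0 + N3) \<le> 1 / (10 * real a * (real k + 1))" .
  define Y where "Y = 5 * a * (k + 1)"
  have Y: "0 < Y" using a by (simp add: Y_def)
  have "E Y + 1 \<le> n" using assms by (simp add: \<nu>_def Y_def)
  hence "norm (e n) \<le> 1 / real Y" by (rule order_trans[OF e_small inverse_of_nat_le[OF Y]])
  moreover have "real Y = 5 * real a * (real k + 1)" by (simp add: Y_def algebra_simps)
  ultimately have "norm (e n) \<le> 1 / (5 * real a * (real k + 1))" by (simp only:)
  with l have "lam n * (N0 + N3) + norm (e n) \<le> 1 / (10 * real a * (real k + 1)) + 1 / (5 * real a * (real k + 1))"
    by (rule add_mono)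
  hence "a * (lam n * (N0 + N3) + norm (e n)) \<le> a * (1 / (10 * real a * (real k + 1)) + 1 / (5 * real a * (real k + 1)))"
    by (intro mult_left_mono) auto
  also have "\<dots> = 3 / (10 * (real k + 1))"
  proof -
    have "x * (1 / (10 * x * y) + 1 / (5 * x * y)) = 3 / (10 * y)" if "x \<noteq> 0" "y \<noteq> 0" for x y :: real
      using that by (simp add: field_simps)
    from this[of "real a" "real k + 1"] show ?thesis using a by simp
  qed
  finally show ?thesis using w_Jz[of n] by linarith
qed

text \<open>The budget behind \<open>\<nu>\<close>, in units of 1/(k + 1): 3/10 for each w against
  its resolvent value (1/10 from lam, 1/5 from e) and 1/5 for the change of parameter, 4/5 in
  all.\<close>

lemma w_Suc:
  assumes "\<nu> k \<le> n"
  shows "norm (w (Suc n) - w n) \<le> norm (z (Suc n) - z n) + 1 / (real k + 1)"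
proof -
  have "w (Suc n) - w n = (w (Suc n) - Jz (Suc n)) + (Jz (Suc n) - Jz n) - (w n - Jz n)" by simp
  also have "norm \<dots> \<le> norm (w (Suc n) - Jz (Suc n)) + norm (Jz (Suc n) - Jz n) + norm (w n - Jz n)"
    using norm_triangle_ineq[of "w (Suc n) - Jz (Suc n)" "Jz (Suc n) - Jz n"]
      norm_triangle_ineq4[of "(w (Suc n) - Jz (Suc n)) + (Jz (Suc n) - Jz n)" "w n - Jz n"]
    by linarith
  also have "\<dots> \<le> 3 / (10 * (real k + 1)) + (norm (z (Suc n) - z n) + 1 / (5 * (real k + 1))) + 3 / (10 * (real k + 1))"
    using assms by (intro add_mono w_Jz_small Jz_Suc) auto
  also have "\<dots> \<le> norm (z (Suc n) - z n) + 1 / (real k + 1)"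
  proof -
    have "3 / (10 * y) + (b + 1 / (5 * y)) + 3 / (10 * y) \<le> b + 1 / y" if "0 < y" for b y :: real
      using that by (simp add: field_simps)
    from this[of "real k + 1"] show ?thesis by simp
  qed
  finally show ?thesis .
qed

text \<open>w extrapolates from z i through z (i + 1), so its distance to s is bounded only by 2 N0
  / (1 - gam) \<le> 2 a N0; the distance from z j to s adds N0.\<close>

lemma w_z_bound: "norm (w i - z j) \<le> real (2 * N')"
proof -
  have "(z (Suc i) - s) - gam i *\<^sub>R (z i - s) = (1 - gam i) *\<^sub>R (w i - s)"
    by (simp add: z_Suc_w algebra_simps)
  hence "norm (w i - s) = (1 / (1 - gam i)) * norm ((z (Suc i) - s) - gam i *\<^sub>R (z i - s))"
    using gam_less_1[of i] by simp
  also have "\<dots> \<le> real a * (2 * real N0)"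
  proof (intro mult_mono inverse_gam)
    have "norm (gam i *\<^sub>R (z i - s)) \<le> 1 * norm (z i - s)"
      unfolding norm_scaleR using gam[of i] gam_less_1[of i] by (intro mult_right_mono) auto
    thus "norm ((z (Suc i) - s) - gam i *\<^sub>R (z i - s)) \<le> 2 * real N0"
      using norm_triangle_ineq4[of "z (Suc i) - s" "gam i *\<^sub>R (z i - s)"] z_near_s[of i] z_near_s[of "Suc i"]
      by simp
  qed auto
  finally have "norm (w i - s) \<le> real a * (2 * real N0)" .
  moreover have "norm (w i - z j) \<le> norm (w i - s) + norm (z j - s)"
    by (rule norm_diff_le)
  ultimately have "norm (w i - z j) \<le> real (2 * a * N0 + N0)" using z_near_s[of j] by simp
  also have "\<dots> \<le> real (2 * N')"
  proof -
    have "1 * N0 \<le> a * N0" using a by (intro mult_le_mono1) simp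
    thus ?thesis unfolding of_nat_le_iff N'_def distrib_left mult.assoc by linarith
  qed
  finally show ?thesis .
qed

lemma \<chi>0_metastable:
  "\<exists>n \<le> \<chi>0 k f. \<forall>i\<in>{n..n + f n}. norm (w i - z i) \<le> 1 / (real k + 1)"
proof -
  define M where "M = max a (\<nu> (RR k - 1))"
  have N': "0 < 2 * N'" using a N0_pos by (simp add: N'_def)
  have "0 < tt k" by (simp add: tt_def less_max_iff_disj)
  hence RR: "0 < RR k" using a by (simp add: RR_def)
  have "\<exists>n \<le> M + theta_r M (tt k) (2 * N' * RR k) (\<lambda>m. tt k + f m) (2 * N' * RR k).
           \<forall>i\<in>{n..n + f n}. norm (w i - z i) \<le> 1 / (real k + 1)"
  proof (rule Suzuki_metastable)
    \<comment> \<open>Level \<open>RR k - 1\<close> gives accuracy exactly 1 / \<open>RR k\<close>,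
      because level k stands for 1/(k + 1).\<close>
    show "norm (w (Suc i) - w i) \<le> norm (z (Suc i) - z i) + 1 / real (RR k)" if "M \<le> i" for i
      using w_Suc[of "RR k - 1" i] that RR by (simp add: M_def of_nat_diff)
    show "2 * N' * a * (k + 1) \<le> tt k" by (simp add: tt_def)
    show "RR k = tt k * (2 * tt k + 1) * a ^ tt k * (k + 1)" by (simp add: RR_def)
  qed (use Q3 a z_Suc_w w_z_bound N' in auto)
  then obtain n where n: "n \<le> M + theta_r M (tt k) (2 * N' * RR k) (\<lambda>m. tt k + f m) (2 * N' * RR k)"
    "\<forall>i\<in>{n..n + f n}. norm (w i - z i) \<le> 1 / (real k + 1)" by blast
  have "RR k - 1 + 1 = RR k" using RR by simp
  hence "n \<le> \<chi>0 k f" using n(1) unfolding \<chi>0_def theta_def Let_def M_def by simp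
  thus ?thesis using n(2) by blast
qed

section \<open>From the moving resolvents to the fixed one\<close>

abbreviation J :: "'a \<Rightarrow> 'a" where "J \<equiv> resolvent T (1 / real c)"

lemma J_nonexpansive: "norm (J x - J y) \<le> norm (x - y)"
  using c by (intro resolvent_nonexpansive) simp

text \<open>As 1/c \<le> \<open>cs n\<close>, the factor in \<open>resolvent_change\<close> is at
  most 1, so lowering the parameter at most doubles the residual.\<close>

lemma J_le_resolvent: "norm (x - J x) \<le> 2 * norm (x - resolvent T (cs n) x)"
proof -
  have r: "0 \<le> 1 - (1 / real c) / cs n" "1 - (1 / real c) / cs n \<le> 1"
    using Q4[of n] cs_pos[of n] c by (auto simp: divide_simps mult.commute)
  have "norm (J x - resolvent T (cs n) x) \<le> \<bar>1 - (1 / real c) / cs n\<bar> * norm (x - resolvent T (cs n) x)"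
    using c cs_pos by (intro resolvent_change) auto
  also have "\<dots> \<le> 1 * norm (x - resolvent T (cs n) x)" using r by (intro mult_right_mono) auto
  finally have "norm (J x - resolvent T (cs n) x) \<le> norm (x - resolvent T (cs n) x)" by simp
  moreover have "norm (x - J x) \<le> norm (x - resolvent T (cs n) x) + norm (J x - resolvent T (cs n) x)"
    by (rule norm_diff_le)
  ultimately show ?thesis by simp
qed

lemma \<xi>_metastable:
  "\<exists>n \<le> \<xi> k f. \<forall>i\<in>{n..n + f n}. norm (z i - J (z i)) \<le> 1 / (real k + 1)"
proof -
  define M where "M = \<mu> (2 * k + 1)"
  obtain n' where n': "n' \<le> \<chi>0 (4 * a * (k + 1)) (f_tilde (2 * k + 1) f)"
    "\<forall>i\<in>{n'..n' + f_tilde (2 * k + 1) f n'}. norm (w i - z i) \<le> 1 / (real (4 * a * (k + 1)) + 1)"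
    using \<chi>0_metastable by blast
  \<comment> \<open>n \<le> M + n', so the summand \<open>\<mu>\<close> in \<open>f_tilde\<close>
    pays for moving the start from n' to n, and the maximum in its argument evaluates f at n
    itself.\<close>
  define n where "n = max M n'"
  have "norm (z i - J (z i)) \<le> 1 / (real k + 1)" if i: "i \<in> {n..n + f n}" for i
  proof -
    have "i \<in> {n'..n' + f_tilde (2 * k + 1) f n'}"
      using i by (auto simp: n_def f_tilde_def M_def)
    hence "norm (w i - z i) \<le> 1 / (real (4 * a * (k + 1)) + 1)" using n' by blast
    also have "\<dots> \<le> 1 / real (4 * a * (k + 1))" using a by (intro inverse_of_nat_le) simp
    also have "\<dots> \<le> 1 / (4 * (real k + 1))"
    proof (rule frac_le)
      show "4 * (real k + 1) \<le> real (4 * a * (k + 1))"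
        using a mult_right_mono[of 1 "real a" "4 * (real k + 1)"] by (simp add: algebra_simps)
    qed (use a in auto)
    finally have wz: "norm (w i - z i) \<le> 1 / (4 * (real k + 1))" .
    have Mi: "M \<le> i" using i by (simp add: n_def)
    define X where "X = 4 * a * (2 * k + 1 + 1) * (N0 + N3)"
    have X: "0 < X" using a N0_pos by (simp add: X_def)
    have "\<l> X \<le> i" using Mi by (simp add: M_def \<mu>_def X_def)
    hence "lam i \<le> 1 / real X" by (rule order_trans[OF Q1 inverse_of_nat_le[OF X]])
    hence "lam i * (N0 + N3) \<le> 1 / real X * (N0 + N3)" by (intro mult_right_mono) auto
    also have "real X = 8 * real a * (real k + 1) * (real N0 + real N3)"
      by (simp add: X_def algebra_simps)
    also have "1 / \<dots> * (N0 + N3) = 1 / (8 * real a * (real k + 1))" using N0_pos a by simp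
    finally have l: "lam i * (N0 + N3) \<le> 1 / (8 * real a * (real k + 1))" .
    define Y where "Y = 4 * a * (2 * k + 1 + 1)"
    have Y: "0 < Y" using a by (simp add: Y_def)
    have "E Y + 1 \<le> i" using Mi by (simp add: M_def \<mu>_def Y_def)
    hence "norm (e i) \<le> 1 / real Y" by (rule order_trans[OF e_small inverse_of_nat_le[OF Y]])
    also have "real Y = 8 * real a * (real k + 1)" by (simp add: Y_def algebra_simps)
    finally have "a * (lam i * (N0 + N3) + norm (e i)) \<le> a * (1 / (8 * real a * (real k + 1)) + 1 / (8 * real a * (real k + 1)))"
      using l by (intro mult_left_mono add_mono) auto
    also have "\<dots> = 1 / (4 * (real k + 1))"
    proof -
      have "x * (1 / (8 * x * y) + 1 / (8 * x * y)) = 1 / (4 * y)" if "x \<noteq> 0" "y \<noteq> 0" for x y :: real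
        using that by (simp add: field_simps)
      from this[of "real a" "real k + 1"] show ?thesis using a by simp
    qed
    finally have wJ: "norm (w i - Jz i) \<le> 1 / (4 * (real k + 1))" using w_Jz[of i] by linarith
    \<comment> \<open>A quarter of 1/(k + 1) each, the second one made of two eighths from lam and
      e; their sum leaves exactly the factor 2 of \<open>J_le_resolvent\<close>.\<close>
    have "norm (z i - Jz i) \<le> norm (w i - z i) + norm (w i - Jz i)"
      using norm_triangle_ineq4[of "w i - Jz i" "w i - z i"] by simp
    also have "\<dots> \<le> 1 / (4 * (real k + 1)) + 1 / (4 * (real k + 1))" using wz wJ by (rule add_mono)
    finally have "2 * norm (z i - Jz i) \<le> 1 / (real k + 1)" by (simp add: field_simps)
    thus ?thesis using J_le_resolvent[of "z i" i] by linarith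
  qed
  moreover have "n \<le> \<xi> k f" using n'(1) by (auto simp: \<xi>_def n_def M_def)
  ultimately show ?thesis by blast
qed

end

section \<open>Approximate projection and Xu recursion\<close>

text \<open>If level j fails, every x at level j + 1 can be exchanged for a point at level j that is closer to u;
  starting from s, this cannot happen R times.\<close>

lemma approximate_projection:
  fixes F :: "nat \<Rightarrow> 'a::real_normed_vector set" and g :: "nat \<Rightarrow> nat"
  assumes s: "\<And>m. s \<in> F m" and \<epsilon>: "0 \<le> \<epsilon>" "(norm (u - s))\<^sup>2 < real R * \<epsilon>"
  shows "\<exists>j<R. \<exists>x\<in>F (g ((g ^^ j) 0)). norm (u - x) \<le> norm (u - s) \<and>
           (\<forall>y\<in>F ((g ^^ j) 0). (norm (u - x))\<^sup>2 \<le> (norm (u - y))\<^sup>2 + \<epsilon>)"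
proof (rule ccontr)
  assume *: "\<not> ?thesis"
  have "\<exists>x\<in>F ((g ^^ (R - i)) 0). (norm (u - x))\<^sup>2 \<le> (norm (u - s))\<^sup>2 - real i * \<epsilon>" if "i \<le> R" for i
    using that
  proof (induction i)
    case 0
    thus ?case using s by auto
  next
    case (Suc i)
    define j where "j = R - Suc i"
    have j: "R - i = Suc j" "j < R" using Suc.prems by (auto simp: j_def)
    obtain x where x: "x \<in> F (g ((g ^^ j) 0))" "(norm (u - x))\<^sup>2 \<le> (norm (u - s))\<^sup>2 - real i * \<epsilon>"
      using Suc j(1) by auto
    have "0 \<le> real i * \<epsilon>" using \<epsilon>(1) by simp
    with x(2) have "(norm (u - x))\<^sup>2 \<le> (norm (u - s))\<^sup>2" by linarith
    hence "norm (u - x) \<le> norm (u - s)" by (rule power2_le_imp_le) simp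
    then obtain y where y: "y \<in> F ((g ^^ j) 0)" "(norm (u - y))\<^sup>2 + \<epsilon> < (norm (u - x))\<^sup>2"
      using * j(2) x(1) by (meson not_le)
    have "(norm (u - y))\<^sup>2 \<le> (norm (u - s))\<^sup>2 - real (Suc i) * \<epsilon>"
      using y(2) x(2) by (simp add: algebra_simps)
    thus ?case using y(1) unfolding j_def by blast
  qed
  from this[of R] obtain x where "(norm (u - x))\<^sup>2 \<le> (norm (u - s))\<^sup>2 - real R * \<epsilon>" by auto
  thus False using \<epsilon>(2) zero_le_power2[of "norm (u - x)"] by linarith
qed

lemma norm_convex_combination:
  fixes x y p :: "'a::real_inner"
  shows "(norm ((1 - t) *\<^sub>R x + t *\<^sub>R y - p))\<^sup>2 =
    (1 - t) * (norm (x - p))\<^sup>2 + t * (norm (y - p))\<^sup>2 - t * (1 - t) * (norm (x - y))\<^sup>2"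
proof -
  define b d where "b = x - p" and "d = y - p"
  have *: "(1 - t) *\<^sub>R x + t *\<^sub>R y - p = (1 - t) *\<^sub>R b + t *\<^sub>R d" "x - y = b - d"
    by (simp_all add: b_def d_def algebra_simps)
  show ?thesis unfolding * b_def[symmetric] d_def[symmetric] power2_norm_eq_inner
    by (simp add: inner_add_left inner_add_right inner_diff_left inner_diff_right
        inner_commute[of d b] algebra_simps)
qed

text \<open>Apply \<open>norm_convex_combination\<close> with p = J v: nonexpansiveness puts J v
  within t d + \<delta> of x and (1 - t) d + \<delta> of y, and all terms in d^2 cancel. What is
  left is 4t(1 - t) d \<delta> + \<delta>^2, so it is the square of the residual that is of order
  \<delta>.\<close>

lemma approximate_fixed_point_convex:
  fixes J :: "'a::real_inner \<Rightarrow> 'a"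
  assumes J: "\<And>x y. norm (J x - J y) \<le> norm (x - y)"
    and x: "norm (x - J x) \<le> \<delta>" and y: "norm (y - J y) \<le> \<delta>"
    and D: "norm (x - y) \<le> D" and t: "0 \<le> t" "t \<le> 1"
  defines "v \<equiv> (1 - t) *\<^sub>R x + t *\<^sub>R y"
  shows "(norm (v - J v))\<^sup>2 \<le> D * \<delta> + \<delta>\<^sup>2"
proof -
  define d where "d = norm (x - y)"
  have \<delta>: "0 \<le> \<delta>" using x norm_ge_zero order_trans by blast
  have "norm (x - J v) \<le> norm (x - v) + \<delta>"
    using norm_triangle_ineq[of "x - J x" "J x - J v"] J[of x v] x by simp
  also have "x - v = t *\<^sub>R (x - y)" by (simp add: v_def algebra_simps)
  finally have xv: "norm (x - J v) \<le> t * d + \<delta>" using t by (simp add: d_def)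
  have "norm (y - J v) \<le> norm (y - v) + \<delta>"
    using norm_triangle_ineq[of "y - J y" "J y - J v"] J[of y v] y by simp
  also have "y - v = (1 - t) *\<^sub>R (y - x)" by (simp add: v_def algebra_simps)
  finally have yv: "norm (y - J v) \<le> (1 - t) * d + \<delta>" using t by (simp add: d_def norm_minus_commute)
  have "(norm (v - J v))\<^sup>2 = (1 - t) * (norm (x - J v))\<^sup>2 + t * (norm (y - J v))\<^sup>2 - t * (1 - t) * d\<^sup>2"
    unfolding d_def by (subst (1) v_def) (rule norm_convex_combination)
  also have "\<dots> \<le> (1 - t) * (t * d + \<delta>)\<^sup>2 + t * ((1 - t) * d + \<delta>)\<^sup>2 - t * (1 - t) * d\<^sup>2"
    using xv yv t by (intro diff_right_mono add_mono mult_left_mono power_mono) auto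
  also have "\<dots> = 4 * (t * (1 - t)) * (d * \<delta>) + \<delta>\<^sup>2"
    by (simp add: power2_eq_square algebra_simps)
  also have "\<dots> \<le> 1 * (D * \<delta>) + \<delta>\<^sup>2"
  proof (intro add_right_mono mult_mono)
    have "0 \<le> (1 - 2 * t)\<^sup>2" by simp
    thus "4 * (t * (1 - t)) \<le> 1" by (simp add: power2_eq_square algebra_simps)
    show "d \<le> D" using D by (simp add: d_def)
  qed (use \<delta> D in \<open>auto simp: d_def intro: order_trans[OF norm_ge_zero]\<close>)
  finally show ?thesis by simp
qed

text \<open>Averaging reproduces b, as (1 - lam) b + lam b = b, so only the initial value decays, by
  1 - lam \<le> exp (- lam), while the errors add up. The stretch is finite because the inner
  products are controlled only there.\<close>

lemma Xu_recursion:
  fixes A lam \<epsilon> :: "nat \<Rightarrow> real"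
  assumes step: "\<And>i. m \<le> i \<Longrightarrow> i < q \<Longrightarrow> A (Suc i) \<le> (1 - lam i) * A i + lam i * b + \<epsilon> i"
    and lam: "\<And>i. 0 \<le> lam i" "\<And>i. lam i \<le> 1" and \<epsilon>: "\<And>i. 0 \<le> \<epsilon> i" and A: "0 \<le> A m" and b: "0 \<le> b"
    and "m \<le> i" "i \<le> q"
  shows "A i \<le> exp (- (\<Sum>j=m..<i. lam j)) * A m + b + (\<Sum>j=m..<i. \<epsilon> j)"
  using \<open>m \<le> i\<close> \<open>i \<le> q\<close>
proof (induction i rule: nat_induct_at_least)
  case base
  thus ?case using b by simp
next
  case (Suc i)
  define P where "P = exp (- (\<Sum>j=m..<i. lam j)) * A m"
  define S where "S = (\<Sum>j=m..<i. \<epsilon> j)"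
  have P0: "0 \<le> P" using A by (simp add: P_def)
  have S0: "0 \<le> S" using \<epsilon> by (simp add: S_def sum_nonneg)
  have "A (Suc i) \<le> (1 - lam i) * A i + lam i * b + \<epsilon> i" using Suc by (intro step) auto
  also have "\<dots> \<le> (1 - lam i) * (P + b + S) + lam i * b + \<epsilon> i"
    using Suc lam by (intro add_right_mono mult_left_mono) (auto simp: P_def S_def)
  also have "\<dots> = (1 - lam i) * P + b + (1 - lam i) * S + \<epsilon> i" by (simp add: algebra_simps)
  also have "\<dots> \<le> exp (- lam i) * P + b + 1 * S + \<epsilon> i"
    using exp_ge_add_one_self[of "- lam i"] P0 S0 lam
    by (intro add_right_mono add_mono mult_right_mono) auto
  also have "exp (- lam i) * P = exp (- (\<Sum>j=m..<Suc i. lam j)) * A m"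
    using Suc by (simp add: P_def exp_add[symmetric] sum.atLeastLessThan_Suc algebra_simps)
  also have "\<dots> + b + 1 * S + \<epsilon> i = \<dots> + b + (\<Sum>j=m..<Suc i. \<epsilon> j)"
    using Suc by (simp add: S_def)
  finally show ?case .
qed

section \<open>Metastability of the iteration\<close>

context halpern_ppa
begin

lemma \<psi>_metastable:
  assumes f: "mono f"
  shows "\<exists>n \<le> \<psi> k f. \<exists>x. norm (u - x) \<le> norm (u - s) \<and> norm (x - J x) \<le> 1 / (real (f n) + 1) \<and>
    (\<forall>i\<in>{n..n + f n + 1}. (u - x) \<bullet> (z i - x) \<le> 1 / (real k + 1))"
proof -
  define F where "F m = {x. norm (x - J x) \<le> 1 / (real m + 1)}" for m
  define K where "K = real k + 1"
  define R where "R = 4 * N ^ 4 * (k + 1)\<^sup>2"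
  \<comment> \<open>With \<open>\<tau>\<close> below, \<epsilon>/(2\<tau>) = 1/(2K) and 2 N^2 \<tau>
    = 1/(4K), together 3/(4K); and R \<epsilon> = N^2/2 exceeds |u - s|^2 \<le> N^2/4.\<close>
  define \<epsilon> where "\<epsilon> = 1 / (8 * (real N)\<^sup>2 * K\<^sup>2)"
  have K: "1 \<le> K" by (simp add: K_def)
  have N: "1 \<le> real N" using N_pos by simp
  have NK: "1 \<le> (real N)\<^sup>2" using N by (simp add: one_le_power)
  have R_eq: "real R = 4 * (real N)\<^sup>2 * (real N)\<^sup>2 * K\<^sup>2"
    by (simp add: R_def K_def power2_eq_square power4_eq_xxxx algebra_simps)
  have us: "2 * norm (u - s) \<le> real N"
    using N3(1) by (simp add: N_def)
  have "\<exists>j<R. \<exists>x\<in>F (g_check f ((g_check f ^^ j) 0)). norm (u - x) \<le> norm (u - s) \<and>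
           (\<forall>y\<in>F ((g_check f ^^ j) 0). (norm (u - x))\<^sup>2 \<le> (norm (u - y))\<^sup>2 + \<epsilon>)"
  proof (rule approximate_projection)
    show "s \<in> F m" for m using resolvent_fixed[of "1 / real c"] c by (simp add: F_def)
    show "0 \<le> \<epsilon>" by (simp add: \<epsilon>_def)
    have "(2 * norm (u - s))\<^sup>2 \<le> (real N)\<^sup>2" using us by (intro power_mono) auto
    moreover have "real R * \<epsilon> = (real N)\<^sup>2 / 2" using N K by (simp add: R_eq \<epsilon>_def)
    ultimately show "(norm (u - s))\<^sup>2 < real R * \<epsilon>" using NK by (simp add: power_mult_distrib)
  qed
  then obtain j x where j: "j < R" and x: "x \<in> F (g_check f ((g_check f ^^ j) 0))"
    and ux: "norm (u - x) \<le> norm (u - s)"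
    and min: "\<And>y. y \<in> F ((g_check f ^^ j) 0) \<Longrightarrow> (norm (u - x))\<^sup>2 \<le> (norm (u - y))\<^sup>2 + \<epsilon>"
    by blast
  define m where "m = (g_check f ^^ j) 0"
  \<comment> \<open>Points on the segment have squared residual at most 3N/(q + 1); this q brings
    the residual below 1/(m + 1), the level at which x is almost optimal.\<close>
  define q where "q = 24 * N * (m + 1)\<^sup>2"
  obtain n where n: "n \<le> \<xi> q (\<lambda>i. f i + 1)"
    and zJ: "\<And>i. i \<in> {n..n + (f n + 1)} \<Longrightarrow> norm (z i - J (z i)) \<le> 1 / (real q + 1)"
    using \<xi>_metastable[of q "\<lambda>i. f i + 1"] by blast
  \<comment> \<open>Of j only j < R is known; the iterates of \<open>g_check\<close> increase, so
    the R-th one bounds m.\<close>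
  have "m \<le> (g_check f ^^ R) 0"
  proof -
    have "y \<le> g_check f y" for y
    proof -
      have "1 * (y + 1) \<le> 24 * N * (y + 1)\<^sup>2"
        using N_pos by (intro mult_le_mono self_le_power) auto
      thus ?thesis by (simp add: g_check_def)
    qed
    hence "(g_check f ^^ i) 0 \<le> (g_check f ^^ Suc i) 0" for i by simp
    from lift_Suc_mono_le[of "\<lambda>i. (g_check f ^^ i) 0", OF this less_imp_le[OF j]]
    show ?thesis by (simp add: m_def)
  qed
  hence "q \<le> 24 * N * ((g_check f ^^ R) 0 + 1)\<^sup>2"
    unfolding q_def by (intro mult_le_mono2 power_mono) auto
  hence "\<xi> q (\<lambda>i. f i + 1) \<le> \<psi> k f"
    unfolding \<psi>_def Let_def R_def by (rule \<xi>_mono) (use f in \<open>simp add: mono_def\<close>)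
  hence n_le: "n \<le> \<psi> k f" using n by simp
  \<comment> \<open>x was chosen before n. \<open>g_of\<close> looks ahead to the bound \<xi> q (f +
    1) on n, and since f is monotone, the accuracy of x suffices for \<open>f n\<close>.\<close>
  have "f n \<le> g_check f m" using monoD[OF f n] by (simp add: g_check_def g_of_def q_def)
  hence "1 / (real (g_check f m) + 1) \<le> 1 / (real (f n) + 1)" by (intro divide_left_mono) auto
  hence xf: "norm (x - J x) \<le> 1 / (real (f n) + 1)" using x by (simp add: F_def m_def)
  have "q \<le> g_check f m" by (simp add: g_check_def q_def)
  hence "1 / (real (g_check f m) + 1) \<le> 1 / (real q + 1)" by (intro divide_left_mono) auto
  hence xq: "norm (x - J x) \<le> 1 / (real q + 1)" using x by (simp add: F_def m_def)
  define \<tau> where "\<tau> = 1 / (8 * (real N)\<^sup>2 * K)"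
  have NK1: "1 \<le> (real N)\<^sup>2 * K" using mult_mono[OF NK K] by simp
  have \<tau>_eq: "\<tau> = 1 / (8 * ((real N)\<^sup>2 * K))" by (simp add: \<tau>_def mult.assoc)
  have \<tau>: "0 < \<tau>" "\<tau> \<le> 1"
  proof -
    have "0 < 1 / (8 * P)" "1 / (8 * P) \<le> 1" if "1 \<le> P" for P :: real
      using that by (auto simp: divide_le_eq_1)
    from this[OF NK1] show "0 < \<tau>" "\<tau> \<le> 1" by (simp_all only: \<tau>_eq)
  qed
  have "(u - x) \<bullet> (z i - x) \<le> 1 / (real k + 1)" if i: "i \<in> {n..n + f n + 1}" for i
  proof -
    define y where "y = (1 - \<tau>) *\<^sub>R x + \<tau> *\<^sub>R z i"
    have zx: "norm (x - z i) \<le> 2 * real N"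
    proof -
      have "norm (x - z i) \<le> norm (x - s) + norm (z i - s)" by (rule norm_diff_le)
      moreover have "norm (x - s) \<le> 2 * norm (u - s)"
        using norm_triangle_ineq4[of "u - s" "u - x"] ux by simp
      ultimately show ?thesis using us z_near_s[of i] N0_le_N by simp
    qed
    have "(norm (y - J y))\<^sup>2 \<le> 2 * real N * (1 / (real q + 1)) + (1 / (real q + 1))\<^sup>2"
      unfolding y_def using xq zJ i zx \<tau>
      by (intro approximate_fixed_point_convex J_nonexpansive) auto
    also have "\<dots> \<le> 3 * real N * (1 / (real q + 1))"
    proof -
      have "(1 / (real q + 1))\<^sup>2 \<le> real N * (1 / (real q + 1))"
        unfolding power2_eq_square
      proof (intro mult_right_mono)
        show "1 / (real q + 1) \<le> real N" using N by (intro order_trans[OF _ N]) (simp add: divide_le_eq)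
      qed simp
      thus ?thesis by simp
    qed
    also have "\<dots> \<le> 3 * real N * (1 / real q)"
      using N_pos by (intro mult_left_mono inverse_of_nat_le) (auto simp: q_def)
    also have "real q = 24 * real N * (real m + 1)\<^sup>2"
      unfolding q_def of_nat_mult of_nat_power of_nat_add of_nat_numeral of_nat_1 ..
    also have "3 * real N * (1 / (24 * real N * (real m + 1)\<^sup>2)) \<le> (1 / (real m + 1))\<^sup>2"
    proof -
      have le: "3 * P * (1 / (24 * P * y\<^sup>2)) \<le> (1 / y)\<^sup>2" if "P \<noteq> 0" for P y :: real
      proof -
        have "3 * P * (1 / (24 * P * y\<^sup>2)) = 1 / 8 * (1 / y)\<^sup>2"
          using that by (simp add: power_one_over)
        thus ?thesis using zero_le_power2[of "1 / y"] by linarith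
      qed
      show ?thesis by (rule le) (use N_pos in simp)
    qed
    finally have "norm (y - J y) \<le> 1 / (real m + 1)" by (rule power2_le_imp_le) simp
    hence "(norm (u - x))\<^sup>2 \<le> (norm (u - y))\<^sup>2 + \<epsilon>" by (intro min) (simp add: F_def m_def)
    moreover have "(norm (u - y))\<^sup>2 = (norm (u - x))\<^sup>2 - 2 * \<tau> * ((u - x) \<bullet> (z i - x)) + \<tau>\<^sup>2 * (norm (x - z i))\<^sup>2"
    proof -
      define b d where "b = u - x" and "d = z i - x"
      have *: "u - y = b - \<tau> *\<^sub>R d" "norm (x - z i) = norm d"
        by (simp add: y_def b_def d_def algebra_simps) (simp add: d_def norm_minus_commute)
      show ?thesis unfolding * b_def[symmetric] d_def[symmetric] power2_norm_eq_inner
        by (simp add: inner_diff_left inner_diff_right inner_commute[of d b] power2_eq_square algebra_simps)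
    qed
    moreover have "\<tau>\<^sup>2 * (norm (x - z i))\<^sup>2 \<le> \<tau>\<^sup>2 * (2 * real N)\<^sup>2"
      using zx by (intro mult_left_mono power_mono) auto
    ultimately have "2 * \<tau> * ((u - x) \<bullet> (z i - x)) \<le> \<tau>\<^sup>2 * (2 * real N)\<^sup>2 + \<epsilon>" by linarith
    also have "\<dots> = 2 * \<tau> * (3 / (4 * K))"
    proof -
      have "(1 / (8 * P * y))\<^sup>2 * (4 * P) + 1 / (8 * P * y\<^sup>2) = 2 * (1 / (8 * P * y)) * (3 / (4 * y))"
        if "P \<noteq> 0" "y \<noteq> 0" for P y :: real
        using that by (simp add: power2_eq_square field_simps)
      moreover have "(real N)\<^sup>2 \<noteq> 0" "K \<noteq> 0" using NK K by linarith+
      moreover have "(2 * real N)\<^sup>2 = 4 * (real N)\<^sup>2" by simp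
      ultimately show ?thesis by (simp only: \<tau>_def \<epsilon>_def)
    qed
    finally have "(u - x) \<bullet> (z i - x) \<le> 3 / (4 * K)"
      by (rule mult_left_le_imp_le) (use \<tau> in simp)
    also have "\<dots> \<le> 1 / K" using K by (simp add: field_simps)
    finally show ?thesis by (simp add: K_def)
  qed
  thus ?thesis using n_le ux xf by blast
qed

section \<open>From the fixed resolvent back to the moving ones\<close>

lemma \<C>_pos: "1 \<le> \<C> n"
proof -
  have "0 < real (\<C> n)" using cs_pos[of n] cs_le[of n] by linarith
  thus ?thesis by simp
qed

lemma h_of_mono: "mono f \<Longrightarrow> mono (h_of f)"
  unfolding h_of_def \<zeta>_def
  by (intro monoI diff_le_mono mult_le_mono add_mono monoD[OF \<C>] order_refl) (auto dest: monoD)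

lemma h_of_eq: "h_of f m + 1 = \<C> (f m) * c * ((1 + 4 * N) * (f m + 1))"
proof -
  have "0 < \<C> (f m) * c * ((1 + 4 * N) * (f m + 1))" using \<C>_pos[of "f m"] c by simp
  thus ?thesis by (simp add: h_of_def \<zeta>_def)
qed

lemma le_h_of: "f m \<le> h_of f m"
proof -
  have "1 * 1 * (1 * (f m + 1)) \<le> h_of f m + 1"
    unfolding h_of_eq using \<C>_pos c by (intro mult_le_mono) (auto simp: Suc_leI)
  thus ?thesis by simp
qed

text \<open>Raising the parameter from 1/c to \<open>cs i\<close> multiplies the residual of x by up
  to c \<open>cs i\<close>. The monotone \<open>\<C>\<close> bounds this by c
  \<open>\<C> (f n)\<close> for i \<le> f n, and \<open>h_of\<close> asks for that much more
  accuracy beforehand.\<close>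

lemma \<Psi>_metastable:
  assumes f: "mono f"
  shows "\<exists>n \<le> \<Psi> k f. \<exists>x. norm (u - x) \<le> norm (u - s) \<and>
    (\<forall>i\<le>f n. norm (x - resolvent T (cs i) x) \<le> 1 / ((1 + 4 * real N) * (real (f n) + 1))) \<and>
    (\<forall>i\<in>{n..n + f n + 1}. (u - x) \<bullet> (z i - x) \<le> 1 / (2 * (real k + 1)))"
proof -
  obtain n x where n: "n \<le> \<Psi> k f" and ux: "norm (u - x) \<le> norm (u - s)"
    and xJ: "norm (x - J x) \<le> 1 / (real (h_of f n) + 1)"
    and inner: "\<And>i. i \<in> {n..n + h_of f n + 1} \<Longrightarrow> (u - x) \<bullet> (z i - x) \<le> 1 / (real (2 * k + 1) + 1)"
    using \<psi>_metastable[OF h_of_mono[OF f], of "2 * k + 1"] unfolding \<Psi>_def by blast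
  have "norm (x - resolvent T (cs i) x) \<le> 1 / ((1 + 4 * real N) * (real (f n) + 1))" if i: "i \<le> f n" for i
  proof -
    have ge: "1 \<le> cs i * c" using Q4[of i] c by (simp add: divide_le_eq)
    have "cs i \<le> \<C> (f n)" using cs_le[of i] monoD[OF \<C> i] by (meson of_nat_mono order_trans)
    hence le: "cs i * c \<le> real (\<C> (f n)) * real c" by (intro mult_right_mono) auto
    have "norm (resolvent T (cs i) x - J x) \<le> \<bar>1 - cs i / (1 / real c)\<bar> * norm (x - J x)"
      using c cs_pos by (intro resolvent_change) auto
    also have "\<dots> = (cs i * c - 1) * norm (x - J x)" using ge by simp
    finally have "norm (resolvent T (cs i) x - J x) \<le> (cs i * c - 1) * norm (x - J x)" .
    moreover have "norm (x - resolvent T (cs i) x) \<le> norm (x - J x) + norm (resolvent T (cs i) x - J x)"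
      by (rule norm_diff_le)
    ultimately have "norm (x - resolvent T (cs i) x) \<le> (cs i * c) * norm (x - J x)"
      by (simp add: algebra_simps)
    also have "\<dots> \<le> (real (\<C> (f n)) * real c) * (1 / (real (h_of f n) + 1))"
      by (rule mult_mono[OF le xJ]) auto
    also have "real (h_of f n) + 1 = (real (\<C> (f n)) * real c) * ((1 + 4 * real N) * (real (f n) + 1))"
    proof -
      have "real (h_of f n) + 1 = real (h_of f n + 1)" by simp
      also have "\<dots> = (real (\<C> (f n)) * real c) * ((1 + 4 * real N) * (real (f n) + 1))"
        unfolding h_of_eq by (simp only: of_nat_mult of_nat_add of_nat_numeral of_nat_1)
      finally show ?thesis .
    qed
    also have "(real (\<C> (f n)) * real c) * (1 / ((real (\<C> (f n)) * real c) * ((1 + 4 * real N) * (real (f n) + 1))))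
        = 1 / ((1 + 4 * real N) * (real (f n) + 1))"
      using \<C>_pos[of "f n"] c by simp
    finally show ?thesis .
  qed
  moreover have "(u - x) \<bullet> (z i - x) \<le> 1 / (2 * (real k + 1))" if "i \<in> {n..n + f n + 1}" for i
    using inner[of i] that le_h_of[of f n] by (simp add: algebra_simps)
  ultimately show ?thesis using n ux by blast
qed

text \<open>With v the new difference without its error, |v|^2 \<le> |v - lam (u - x)|^2 + 2 lam <u
  - x, v>, and v - lam (u - x) combines z n - x and Jz n - x with total weight 1 - lam. Squaring
  yields (1 + 4N) \<eta>, from |z n - x| \<le> 2N and \<eta> \<le> 1. Restoring the error adds 4N |e
  n| in the square and 2 N3 |e n| in the inner product.\<close>

lemma z_Suc_recursion:
  assumes ux: "norm (u - x) \<le> norm (u - s)"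
    and \<eta>: "norm (x - resolvent T (cs n) x) \<le> \<eta>" "\<eta> \<le> 1"
    and B: "norm (z n - x) \<le> 2 * real N" "norm (z (Suc n) - x) \<le> 2 * real N"
  shows "(norm (z (Suc n) - x))\<^sup>2 \<le> (1 - lam n) * (norm (z n - x))\<^sup>2
    + lam n * (2 * ((u - x) \<bullet> (z (Suc n) - x))) + ((1 + 4 * real N) * \<eta> + (2 * real N3 + 4 * real N) * norm (e n))"
proof -
  define y where "y = z (Suc n) - x"
  define v where "v = y - e n"
  define b where "b = norm (z n - x)"
  define l where "l = lam n"
  have l: "0 < l" "l < 1" using lam by (auto simp: l_def)
  have \<eta>0: "0 \<le> \<eta>" using \<eta>(1) norm_ge_zero order_trans by blast
  have v_eq: "v - l *\<^sub>R (u - x) = gam n *\<^sub>R (z n - x) + del n *\<^sub>R (Jz n - x)"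
  proof -
    have "lam n *\<^sub>R x + gam n *\<^sub>R x + del n *\<^sub>R x = x"
      by (metis scaleR_left_distrib scaleR_one sum1)
    thus ?thesis unfolding v_def y_def z_Suc l_def by (simp add: algebra_simps)
  qed
  have "norm (Jz n - x) \<le> b + \<eta>"
    using resolvent_nonexpansive[OF cs_pos[of n], of "z n" x] \<eta>(1)
      norm_triangle_ineq4[of "Jz n - resolvent T (cs n) x" "x - resolvent T (cs n) x"]
    by (simp add: b_def)
  hence "del n * norm (Jz n - x) \<le> del n * (b + \<eta>)" using del[of n] by simp
  moreover have "norm (gam n *\<^sub>R (z n - x)) = gam n * b"
    "norm (del n *\<^sub>R (Jz n - x)) = del n * norm (Jz n - x)"
    using gam[of n] del[of n] by (simp_all add: b_def)
  ultimately have "norm (v - l *\<^sub>R (u - x)) \<le> gam n * b + del n * (b + \<eta>)"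
    unfolding v_eq using norm_triangle_ineq[of "gam n *\<^sub>R (z n - x)" "del n *\<^sub>R (Jz n - x)"]
    by linarith
  also have "\<dots> = (gam n + del n) * b + del n * \<eta>" by (simp add: algebra_simps)
  also have "gam n + del n = 1 - l" using sum1[of n] by (simp add: l_def)
  also have "(1 - l) * b + del n * \<eta> \<le> (1 - l) * b + \<eta>"
  proof -
    have "del n \<le> 1" using sum1[of n] lam(1)[of n] gam[of n] by simp
    thus ?thesis using mult_right_mono[OF _ \<eta>0, of "del n" 1] by simp
  qed
  finally have "norm (v - l *\<^sub>R (u - x)) \<le> (1 - l) * b + \<eta>" .
  hence "(norm (v - l *\<^sub>R (u - x)))\<^sup>2 \<le> ((1 - l) * b + \<eta>)\<^sup>2" by (rule power_mono) simp
  also have "\<dots> = (1 - l) * ((1 - l) * b\<^sup>2) + 2 * ((1 - l) * b) * \<eta> + \<eta> * \<eta>"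
    by (simp add: power2_eq_square algebra_simps)
  also have "\<dots> \<le> 1 * ((1 - l) * b\<^sup>2) + 2 * (1 * (2 * real N)) * \<eta> + 1 * \<eta>"
    using l B \<eta>0 \<eta> by (intro add_mono mult_right_mono mult_left_mono mult_mono) (auto simp: b_def)
  finally have p: "(norm (v - l *\<^sub>R (u - x)))\<^sup>2 \<le> (1 - l) * b\<^sup>2 + (1 + 4 * real N) * \<eta>"
    by (simp add: algebra_simps)
  have "(norm (v - l *\<^sub>R (u - x)))\<^sup>2 = (norm v)\<^sup>2 - 2 * l * ((u - x) \<bullet> v) + l\<^sup>2 * (norm (u - x))\<^sup>2"
    unfolding power2_norm_eq_inner
    by (simp add: inner_diff_left inner_diff_right inner_commute power2_eq_square algebra_simps)
  note * = this
  have v_le: "(norm v)\<^sup>2 \<le> (1 - l) * b\<^sup>2 + (1 + 4 * real N) * \<eta> + 2 * l * ((u - x) \<bullet> v)"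
  proof -
    have "0 \<le> l\<^sup>2 * (norm (u - x))\<^sup>2" by simp
    with * p show ?thesis by linarith
  qed
  have "(norm v)\<^sup>2 = (norm y)\<^sup>2 - 2 * (y \<bullet> e n) + (norm (e n))\<^sup>2"
    unfolding power2_norm_eq_inner v_def
    by (simp add: inner_diff_left inner_diff_right inner_commute)
  hence "(norm y)\<^sup>2 \<le> (norm v)\<^sup>2 + 2 * (y \<bullet> e n)" by simp
  moreover have "y \<bullet> e n \<le> 2 * real N * norm (e n)"
    using norm_cauchy_schwarz[of y "e n"] mult_right_mono[OF B(2), of "norm (e n)"] by (simp add: y_def)
  ultimately have y_le: "(norm y)\<^sup>2 \<le> (norm v)\<^sup>2 + 4 * real N * norm (e n)" by simp
  have "(u - x) \<bullet> v = (u - x) \<bullet> y - (u - x) \<bullet> e n" by (simp add: v_def inner_diff_right)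
  moreover have "- ((u - x) \<bullet> e n) \<le> real N3 * norm (e n)"
  proof -
    have "- ((u - x) \<bullet> e n) \<le> norm (u - x) * norm (e n)"
      using Cauchy_Schwarz_ineq2[of "u - x" "e n"] by simp
    also have "\<dots> \<le> real N3 * norm (e n)" using ux N3(1) by (intro mult_right_mono) auto
    finally show ?thesis .
  qed
  ultimately have "(u - x) \<bullet> v \<le> (u - x) \<bullet> y + real N3 * norm (e n)" by linarith
  hence "2 * l * ((u - x) \<bullet> v) \<le> 2 * l * ((u - x) \<bullet> y + real N3 * norm (e n))"
    using l by (intro mult_left_mono) auto
  also have "\<dots> = l * (2 * ((u - x) \<bullet> y)) + l * (2 * (real N3 * norm (e n)))" by (simp add: algebra_simps)
  also have "\<dots> \<le> l * (2 * ((u - x) \<bullet> y)) + 1 * (2 * (real N3 * norm (e n)))"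
    using l by (intro add_left_mono mult_right_mono) auto
  finally have "(norm y)\<^sup>2 \<le> (1 - l) * b\<^sup>2 + (1 + 4 * real N) * \<eta> + (l * (2 * ((u - x) \<bullet> y)) + 2 * (real N3 * norm (e n)))
      + 4 * real N * norm (e n)"
    using y_le v_le by linarith
  thus ?thesis unfolding y_def[symmetric] b_def[symmetric] l_def[symmetric] by (simp add: algebra_simps)
qed

lemma h'_mono: "mono (h' k)"
  unfolding h'_def by (intro monoI add_mono max.mono) auto

lemma g'_mono:
  assumes f: "mono f"
  shows "mono (g' k f)"
proof (rule monoI)
  fix m m' :: nat assume "m \<le> m'"
  hence "f (L (h' k m) + 1) \<le> f (L (h' k m') + 1)"
    by (intro monoD[OF f] add_mono monoD[OF L] monoD[OF h'_mono]) auto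
  thus "g' k f m \<le> g' k f m'" unfolding g'_def by (intro mult_le_mono2 add_mono) auto
qed

text \<open>Decay of the initial value, inner products, resolvent residuals and errors e get 1/(4(k
  + 1)) each. The stage \<open>\<Psi>\<close> supplies n0 and x before n is formed from n0, so its
  counterfunction \<open>g'\<close> has to foresee the window from n to f n, whose end point is
  absolute.\<close>

lemma \<Theta>_metastable:
  assumes f: "mono f"
  shows "\<exists>n \<le> \<Theta> k f. \<exists>x. \<forall>i\<in>{n..f n}. (norm (z i - x))\<^sup>2 \<le> 1 / (real k + 1)"
proof -
  define K where "K = real k + 1"
  have K: "0 < K" by (simp add: K_def)
  obtain n0 x where n0: "n0 \<le> \<Psi> (4 * k + 3) (g' k f)" and ux: "norm (u - x) \<le> norm (u - s)"
    and xJ: "\<And>i. i \<le> g' k f n0 \<Longrightarrow>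
      norm (x - resolvent T (cs i) x) \<le> 1 / ((1 + 4 * real N) * (real (g' k f n0) + 1))"
    and inner: "\<And>i. i \<in> {n0..n0 + g' k f n0 + 1} \<Longrightarrow> (u - x) \<bullet> (z i - x) \<le> 1 / (2 * (real (4 * k + 3) + 1))"
    using \<Psi>_metastable[OF g'_mono[OF f, of k], of "4 * k + 3"] by blast
  define g where "g = g' k f n0"
  define q where "q = h' k n0"
  define n where "n = L q + 1"
  define m where "m = max n0 (G (4 * k + 3) + 1)"
  define cl where "cl = nat \<lceil>ln (real (4 * D * (k + 1)))\<rceil>"
  have q: "q = m + cl" by (simp add: q_def h'_def m_def cl_def)
  have g: "g = 4 * (k + 1) * (f n + 1)" by (simp add: g_def g'_def n_def q_def)
  have "q \<le> h' k (\<Psi> (4 * k + 3) (g' k f))" unfolding q_def by (rule monoD[OF h'_mono n0])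
  hence n_le: "n \<le> \<Theta> k f" using monoD[OF L] by (simp add: n_def \<Theta>_def)
  have zx: "norm (z i - x) \<le> 2 * real N" for i
  proof -
    have "norm (z i - x) \<le> norm (z i - s) + norm (x - s)" by (rule norm_diff_le)
    moreover have "norm (x - s) \<le> 2 * norm (u - s)"
      using norm_triangle_ineq4[of "u - s" "u - x"] ux by simp
    moreover have "2 * norm (u - s) \<le> real N" using N3(1) by (simp add: N_def)
    ultimately show ?thesis using z_near_s[of i] N0_le_N by simp
  qed
  have lam01: "0 \<le> lam i" "lam i \<le> 1" for i using lam[of i] by auto
  have sum_lam_le: "(\<Sum>i\<in>A. lam i) \<le> card A" for A
    using sum_bounded_above[of A lam 1] lam01 by simp
  have "(norm (z i - x))\<^sup>2 \<le> 1 / K" if i: "i \<in> {n..f n}" for i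
  proof -
    \<comment> \<open>As lam \<le> 1, a sum of at least q needs at least q terms. So m \<le> q \<le>
      L q < i, and the recursion from m to i runs through all indices from m to L q.\<close>
    have "real q \<le> L q" using Q2[of q] sum_lam_le[of "{1..L q}"] by simp
    hence mi: "m \<le> i" "L q < i" using i q by (auto simp: n_def)
    have m1: "1 \<le> m" by (simp add: m_def)
    have fn: "f n \<le> g"
    proof -
      have "1 * (f n + 1) \<le> 4 * (k + 1) * (f n + 1)" by (intro mult_le_mono1) simp
      thus ?thesis by (simp add: g)
    qed
    define \<epsilon> where "\<epsilon> j = 1 / (real g + 1) + (2 * real N3 + 4 * real N) * norm (e j)" for j
    have "(norm (z i - x))\<^sup>2 \<le> exp (- (\<Sum>j=m..<i. lam j)) * (norm (z m - x))\<^sup>2 + 1 / (4 * K) + (\<Sum>j=m..<i. \<epsilon> j)"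
    proof (rule Xu_recursion)
      fix j assume j: "m \<le> j" "j < i"
      define \<eta> where "\<eta> = 1 / ((1 + 4 * real N) * (real g + 1))"
      have "1 * 1 \<le> (1 + 4 * real N) * (real g + 1)" by (intro mult_mono) auto
      hence \<eta>: "\<eta> \<le> 1" "(1 + 4 * real N) * \<eta> = 1 / (real g + 1)" by (auto simp: \<eta>_def divide_le_eq)
      have "j \<le> g" using j i fn by simp
      hence "norm (x - resolvent T (cs j) x) \<le> \<eta>" using xJ[of j] by (simp add: g_def \<eta>_def)
      hence "(norm (z (Suc j) - x))\<^sup>2 \<le> (1 - lam j) * (norm (z j - x))\<^sup>2
          + lam j * (2 * ((u - x) \<bullet> (z (Suc j) - x))) + \<epsilon> j"
        using z_Suc_recursion[OF ux _ \<eta>(1) zx zx, of j] by (simp only: \<epsilon>_def \<eta>(2))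
      moreover have "2 * ((u - x) \<bullet> (z (Suc j) - x)) \<le> 1 / (4 * K)"
      proof -
        have "(u - x) \<bullet> (z (Suc j) - x) \<le> 1 / (2 * (real (4 * k + 3) + 1))"
          using j i fn by (intro inner) (auto simp: g_def m_def)
        also have "real (4 * k + 3) + 1 = 4 * K" by (simp add: K_def)
        finally show ?thesis by simp
      qed
      hence "lam j * (2 * ((u - x) \<bullet> (z (Suc j) - x))) \<le> lam j * (1 / (4 * K))"
        using lam01(1) by (rule mult_left_mono)
      ultimately show "(norm (z (Suc j) - x))\<^sup>2 \<le> (1 - lam j) * (norm (z j - x))\<^sup>2
          + lam j * (1 / (4 * K)) + \<epsilon> j" by linarith
    qed (use lam01 mi K in \<open>auto simp: \<epsilon>_def\<close>)
    also have "exp (- (\<Sum>j=m..<i. lam j)) * (norm (z m - x))\<^sup>2 \<le> 1 / (4 * K)"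
    proof -
      have D: "0 < D" using N_pos by (simp add: D_def)
      have D_eq: "real (4 * D * (k + 1)) = 4 * real D * K" by (simp add: K_def algebra_simps)
      \<comment> \<open>Of the mass q = m + cl at most m is spent before index m, which leaves
        \<open>cl\<close> \<ge> ln (4DK); D = (2N)^2 bounds the initial square.\<close>
      have "real q \<le> (\<Sum>j=1..L q. lam j)" by (rule Q2)
      also have "\<dots> \<le> (\<Sum>j\<in>{1..<m} \<union> {m..<i}. lam j)"
        using mi lam01 by (intro sum_mono2) auto
      also have "\<dots> = (\<Sum>j=1..<m. lam j) + (\<Sum>j=m..<i. lam j)"
        by (intro sum.union_disjoint) auto
      also have "(\<Sum>j=1..<m. lam j) \<le> real m" using sum_lam_le[of "{1..<m}"] by simp
      finally have "real cl \<le> (\<Sum>j=m..<i. lam j)" by (simp add: q)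
      moreover have "ln (4 * real D * K) \<le> real cl" unfolding cl_def D_eq by linarith
      ultimately have "exp (- (\<Sum>j=m..<i. lam j)) \<le> exp (- ln (4 * real D * K))" by simp
      also have "\<dots> = 1 / (4 * real D * K)" using D K by (simp add: exp_minus inverse_eq_divide)
      finally have "exp (- (\<Sum>j=m..<i. lam j)) * (norm (z m - x))\<^sup>2 \<le> 1 / (4 * real D * K) * (2 * real N)\<^sup>2"
        using zx K by (intro mult_mono power_mono) auto
      also have "(2 * real N)\<^sup>2 = real D" by (simp add: D_def power_mult_distrib)
      finally show ?thesis using D by simp
    qed
    also have "(\<Sum>j=m..<i. \<epsilon> j) \<le> 1 / (4 * K) + 1 / (4 * K)"
    proof -
      have "(\<Sum>j=m..<i. \<epsilon> j) = real (i - m) * (1 / (real g + 1)) + (2 * real N3 + 4 * real N) * (\<Sum>j=m..<i. norm (e j))"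
        by (simp add: \<epsilon>_def sum.distrib sum_distrib_left)
      \<comment> \<open>Fewer than f n + 1 steps, each with error 1/(g + 1); this fixes the factor 4
        (k + 1)(f n + 1) in \<open>g'\<close>.\<close>
      also have "real (i - m) * (1 / (real g + 1)) \<le> 1 / (4 * K)"
      proof -
        have "real (i - m) * (4 * K) \<le> (real (f n) + 1) * (4 * K)"
          using i K by (intro mult_right_mono) auto
        also have "\<dots> = real g" by (simp add: g K_def algebra_simps)
        finally show ?thesis using K by (simp add: divide_simps algebra_simps)
      qed
      also have "(2 * real N3 + 4 * real N) * (\<Sum>j=m..<i. norm (e j)) \<le> 1 / (4 * K)"
      proof -
        define X where "X = M2 * (4 * k + 3 + 1)"
        have M2: "0 < M2" "2 * real N3 + 4 * real N \<le> real M2" using N_pos by (auto simp: M2_def M1_def)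
        have X_eq: "real X = real M2 * (4 * K)" by (simp add: X_def K_def algebra_simps)
        have "(\<Sum>j=m..<i. norm (e j)) \<le> (\<Sum>j=E X + 1..E X + i. norm (e j))"
          by (intro sum_mono2) (auto simp: m_def G_def X_def)
        also have "\<dots> \<le> 1 / (real X + 1)" by (rule Q6)
        also have "\<dots> \<le> 1 / real X" using M2 by (intro inverse_of_nat_le) (simp add: X_def)
        finally have "(2 * real N3 + 4 * real N) * (\<Sum>j=m..<i. norm (e j)) \<le> real M2 * (1 / real X)"
          using M2 by (intro mult_mono sum_nonneg) auto
        also have "\<dots> = 1 / (4 * K)" using M2 K by (simp add: X_eq)
        finally show ?thesis .
      qed
      finally show ?thesis by simp
    qed
    finally show ?thesis using K by (simp add: field_simps)
  qed
  thus ?thesis using n_le unfolding K_def by blast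
qed

text \<open>Squared distances to a common x of at most 1/(4 (k + 1)^2) give 1/(2 (k + 1)) for each
  of two points. \<open>maj\<close> makes the counterfunction monotone, and the summand m turns the
  length f n into the absolute end point used by \<open>\<Theta>\<close>.\<close>

lemma \<phi>_metastable:
  "\<exists>n \<le> \<phi> k f. \<forall>i\<in>{n..n + f n}. \<forall>j\<in>{n..n + f n}. norm (z i - z j) \<le> 1 / (real k + 1)"
proof -
  have maj_mono: "maj f m \<le> maj f m'" if "m \<le> m'" for m m'
    unfolding maj_def using that by (intro Max_mono) auto
  have maj_le: "f m \<le> maj f m" for m unfolding maj_def by (intro Max_ge) auto
  have "mono (\<lambda>m. m + maj f m)" by (intro monoI add_mono maj_mono)
  from \<Theta>_metastable[OF this, of "4 * (k + 1)\<^sup>2 - 1"] obtain n x where n: "n \<le> \<phi> k f"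
    and x: "\<And>i. i \<in> {n..n + maj f n} \<Longrightarrow> (norm (z i - x))\<^sup>2 \<le> 1 / (real (4 * (k + 1)\<^sup>2 - 1) + 1)"
    unfolding \<phi>_def by blast
  have "4 * (k + 1)\<^sup>2 - 1 + 1 = (2 * (k + 1))\<^sup>2" by (simp add: power2_eq_square)
  hence "real (4 * (k + 1)\<^sup>2 - 1) + 1 = real ((2 * (k + 1))\<^sup>2)" by (metis of_nat_1 of_nat_add)
  hence eq: "real (4 * (k + 1)\<^sup>2 - 1) + 1 = (2 * (real k + 1))\<^sup>2"
    unfolding of_nat_power of_nat_mult of_nat_add of_nat_numeral of_nat_1 .
  have "(norm (z i - x))\<^sup>2 \<le> (1 / (2 * (real k + 1)))\<^sup>2" if "i \<in> {n..n + maj f n}" for i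
    using x[OF that] unfolding eq power_one_over .
  hence half: "norm (z i - x) \<le> 1 / (2 * (real k + 1))" if "i \<in> {n..n + maj f n}" for i
    by (rule power2_le_imp_le) (use that in auto)
  have "norm (z i - z j) \<le> 1 / (real k + 1)" if "i \<in> {n..n + f n}" "j \<in> {n..n + f n}" for i j
  proof -
    have "i \<in> {n..n + maj f n}" "j \<in> {n..n + maj f n}" using that maj_le[of n] by auto
    with half have "norm (z i - x) + norm (z j - x) \<le> 1 / (2 * (real k + 1)) + 1 / (2 * (real k + 1))"
      by (intro add_mono) auto
    also have "\<dots> = 1 / (real k + 1)" by (simp add: field_simps)
    finally show ?thesis using norm_diff_le[of "z i" "z j" x] by linarith
  qed
  thus ?thesis using n by blast
qed

end

theorem theorem4p12:
  fixes T :: "'a::{real_inner, complete_space} \<Rightarrow> 'a set"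
    and u z0 :: 'a
    and z e :: "nat \<Rightarrow> 'a"
    and cs lam gam del :: "nat \<Rightarrow> real"
    and a c N1 N2 N3 :: nat
    and \<l> L \<Gamma> E \<C> :: "nat \<Rightarrow> nat"
  assumes T: "maximal_monotone_operator T"
    and S: "zeros T \<noteq> {}"
    and cs_pos: "\<forall>n. 0 < cs n"
    and lam: "\<forall>n. 0 < lam n \<and> lam n < 1"
    and gam: "\<forall>n. 0 < gam n \<and> gam n < 1"
    and del: "\<forall>n. 0 < del n \<and> del n < 1"
    and sum1: "\<forall>n. lam n + gam n + del n = 1"
    and z_0: "z 0 = z0"
    and z_Suc: "\<forall>n. z (Suc n) =
      lam n *\<^sub>R u + gam n *\<^sub>R z n + del n *\<^sub>R resolvent T (cs n) (z n) + e n"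
    and ac: "a \<noteq> 0" "c \<noteq> 0"
    and mono: "mono \<l>" "mono L" "mono \<Gamma>" "mono E"
    and Q1: "\<forall>k. \<forall>n\<ge>\<l> k. lam n \<le> 1 / (real k + 1)"
    and Q2: "\<forall>k. (\<Sum>i=1..L k. lam i) \<ge> real k"
    and Q3: "\<forall>m. 1 / real a \<le> gam m \<and> gam m \<le> 1 - 1 / real a"
    and Q4: "\<forall>n. cs n \<ge> 1 / real c"
    and Q5: "\<forall>k. \<forall>n\<ge>\<Gamma> k. \<bar>cs (n + 1) - cs n\<bar> \<le> 1 / (real k + 1)"
    and Q6: "\<forall>k n. (\<Sum>i=E k + 1..E k + n. norm (e i)) \<le> 1 / (real k + 1)"
    and C: "mono \<C>" "\<forall>n. cs n \<le> real (\<C> n)"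
    and N1: "real N1 \<ge> norm u"
    and N2: "real N2 \<ge> (\<Sum>i=0..E 0. norm (e i)) + 1"
    and N3: "\<exists>s\<in>zeros T. real N3 \<ge> max (norm (u - s)) (norm (z0 - s))"
  shows "\<forall>(k::nat) (f::nat \<Rightarrow> nat). \<exists>n \<le> rate_data.\<phi> a c \<l> L \<Gamma> E \<C> N1 N2 N3 k f.
           \<forall>i\<in>{n..n + f n}. \<forall>j\<in>{n..n + f n}. norm (z i - z j) \<le> 1 / (real k + 1)"
proof -
  obtain s where s: "s \<in> zeros T" "norm (u - s) \<le> N3" "norm (z 0 - s) \<le> N3"
    using N3 z_0 by auto
  interpret halpern_ppa a c \<l> L \<Gamma> E \<C> N1 N2 N3 T s u z e cs lam gam del
  proof unfold_locales
    show "0 < a" "0 < c" using ac by auto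
    show "maximal_monotone_operator T" "s \<in> zeros T" by fact+
    show "norm (u - s) \<le> real N3" "norm (z 0 - s) \<le> real N3" by fact+
    show "mono \<l>" "mono L" "mono \<Gamma>" "mono E" "mono \<C>" by fact+
    show "(\<Sum>i=0..E 0. norm (e i)) + 1 \<le> real N2" by fact
    fix n k m :: nat
    show "0 < cs n" using cs_pos by blast
    show "0 < lam n" "lam n < 1" using lam by blast+
    show "0 < gam n" using gam by blast
    show "0 < del n" using del by blast
    show "lam n + gam n + del n = 1" using sum1 by blast
    show "z (Suc n) = lam n *\<^sub>R u + gam n *\<^sub>R z n + del n *\<^sub>R resolvent T (cs n) (z n) + e n"
      using z_Suc by blast
    show "1 / real a \<le> gam m" "gam m \<le> 1 - 1 / real a" using Q3 by blast+
    show "1 / real c \<le> cs n" using Q4 by blast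
    show "lam n \<le> 1 / (real k + 1)" if "\<l> k \<le> n" using Q1 that by blast
    show "real k \<le> (\<Sum>i=1..L k. lam i)" using Q2 by blast
    show "\<bar>cs (n + 1) - cs n\<bar> \<le> 1 / (real k + 1)" if "\<Gamma> k \<le> n" using Q5 that by blast
    show "(\<Sum>i=E k + 1..E k + n. norm (e i)) \<le> 1 / (real k + 1)" using Q6 by blast
    show "cs n \<le> real (\<C> n)" using C by blast
  qed
  show ?thesis using \<phi>_metastable by blast
qed

end
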